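(* Let $n\in\mathbb{N}_+=\{1,2,\dots\}$ and let $f\in L^2(\mathbb{R}^d)$ (so that $Wf\in L^2(\mathbb{R}^{2d})$). Let $(z,\zeta)\in\mathbb{R}^{2d}\times\mathbb{R}^{2d}$, with $\zeta=(\zeta_1,\zeta_2)\in\mathbb{R}^d\times\mathbb{R}^d$ satisfying $\zeta_1\cdot\zeta_2\ne0$. Then $(z,\zeta)\notin WF_{H^{2n}}(Q^nf)$, i.e. the Born--Jordan distribution $Q^nf$ of order $n$ of $f$ has regularity $H^{2n}$ at $z$ and in the direction $\zeta$.
   Context: Write $x\omega=x\cdot\omega$ for the scalar product in $\mathbb{R}^d$. The Wigner distribution of $f\in L^2(\mathbb{R}^d)$ is $Wf(x,\omega)=\int_{\mathbb{R}^d} f(x+\frac y2)\overline{f(x-\frac y2)}e^{-2\pi i y\omega}\,dy$, $(x,\omega)\in\mathbb{R}^{2d}$. The symplectic form is $\sigma((x,\omega),(\zeta_1,\zeta_2))=\omega\cdot\zeta_1-x\cdot\zeta_2$, and the symplectic Fourier transform on $\mathbb{R}^{2d}$ is $\mathcal{F}_\sigma F(\zeta)=\int_{\mathbb{R}^{2d}}e^{-2\pi i\sigma(\zeta,z)}F(z)\,dz$ (extended to tempered distributions); it is an involution. Let $\mathrm{sinc}(t)=\frac{\sin(\pi t)}{\pi t}$ for $t\ne0$, $\mathrm{sinc}(0)=1$, and $\Theta^n(x,\omega)=\mathrm{sinc}^n(x\cdot\omega)$ on $\mathbb{R}^{2d}$. The Born--Jordan distribution of order $n$ is $Q^nf=Wf*\mathcal{F}_\sigma(\Theta^n)$;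 equivalently, $\mathcal{F}_\sigma(Q^nf)=\Theta^n\cdot\mathcal{F}_\sigma(Wf)$. $H^s$ wave-front set: let $\mathcal{F}F(\omega)=\int e^{-2\pi i x\omega}F(x)\,dx$ and $\langle\omega\rangle=(1+|\omega|^2)^{1/2}$. For $F\in\mathcal{S}'(\mathbb{R}^m)$ and $s\in\mathbb{R}$, the set $WF_{H^s}(F)\subset\mathbb{R}^m\times(\mathbb{R}^m\setminus\{0\})$ is the set of points $(x_0,\omega_0)$, $\omega_0\ne0$, for which the following condition is NOT satisfied: there exist $\varphi\in C_c^\infty(\mathbb{R}^m)$ with $\varphi(x_0)\neq0$ and an open conic neighbourhood $\Gamma\subset\mathbb{R}^m\setminus\{0\}$ of $\omega_0$ such that $\|\mathcal{F}[\varphi F](\omega)\langle\omega\rangle^s\|_{L^2(\Gamma)}<\infty$. *)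

theory Defs
  imports "HOL-Analysis.Analysis"
begin

section \<open>Test functions\<close>

primrec iter_deriv :: "'a::euclidean_space list \<Rightarrow> ('a \<Rightarrow> complex) \<Rightarrow> 'a \<Rightarrow> complex" where
  "iter_deriv [] f = f"
| "iter_deriv (b # bs) f = (\<lambda>x. frechet_derivative (iter_deriv bs f) (at x) b)"

text \<open>If all iterated partial derivatives are (totally) differentiable, they are all continuous,
  so the following is \<open>C\<^sup>\<infinity>\<close>. The lists of basis vectors play the role of multi-indices.\<close>

definition smooth :: "('a::euclidean_space \<Rightarrow> complex) \<Rightarrow> bool" where
  "smooth f \<longleftrightarrow> (\<forall>bs x. set bs \<subseteq> Basis \<longrightarrow> iter_deriv bs f differentiable (at x))"

definition schwartz :: "('a::euclidean_space \<Rightarrow> complex) \<Rightarrow> bool" where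
  "schwartz f \<longleftrightarrow> smooth f \<and>
     (\<forall>k bs. set bs \<subseteq> Basis \<longrightarrow> bounded (range (\<lambda>x. norm x ^ k *\<^sub>R iter_deriv bs f x)))"

definition compactly_supported :: "('a::euclidean_space \<Rightarrow> complex) \<Rightarrow> bool" where
  "compactly_supported f \<longleftrightarrow> compact (closure {x. f x \<noteq> 0})"

definition square_integrable :: "('a::euclidean_space \<Rightarrow> complex) \<Rightarrow> bool" where
  "square_integrable f \<longleftrightarrow>
     f \<in> borel_measurable lebesgue \<and> integrable lebesgue (\<lambda>x. (norm (f x))\<^sup>2)"


section \<open>Tempered distributions\<close>

text \<open>A tempered distribution is represented by its pairing with test functions. Only the values
  on Schwartz functions carry meaning; two functionals that agree on all Schwartz functions
  represent the same distribution. The operations below are the usual transposes.\<close>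

type_synonym 'a distr = "('a \<Rightarrow> complex) \<Rightarrow> complex"

definition regular_distr :: "('a::euclidean_space \<Rightarrow> complex) \<Rightarrow> 'a distr" where
  "regular_distr g \<psi> = (LINT x|lebesgue. g x * \<psi> x)"

definition represents :: "('a::euclidean_space \<Rightarrow> complex) \<Rightarrow> 'a distr \<Rightarrow> bool" where
  "represents g u \<longleftrightarrow>
     (\<forall>\<psi>. schwartz \<psi> \<longrightarrow> integrable lebesgue (\<lambda>x. g x * \<psi> x) \<and> u \<psi> = regular_distr g \<psi>)"

definition mult_distr :: "('a::euclidean_space \<Rightarrow> complex) \<Rightarrow> 'a distr \<Rightarrow> 'a distr" where
  "mult_distr \<phi> u \<psi> = u (\<lambda>x. \<phi> x * \<psi> x)"

text \<open>\<open>\<langle>u * v, \<psi>\<rangle> = \<langle>u\<^sub>x, \<langle>v\<^sub>y, \<psi> (x + y)\<rangle>\<rangle>\<close>; this is meaningful when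
  \<open>x \<mapsto> \<langle>v\<^sub>y, \<psi> (x + y)\<rangle>\<close> is a Schwartz function for every Schwartz function \<open>\<psi>\<close>, i.e. when the
  Fourier transform of \<open>v\<close> is a smooth function all of whose derivatives have polynomial growth,
  as is the case for \<open>theta n\<close> below.\<close>

definition conv_distr :: "'a::euclidean_space distr \<Rightarrow> 'a distr \<Rightarrow> 'a distr" where
  "conv_distr u v \<psi> = u (\<lambda>x. v (\<lambda>y. \<psi> (x + y)))"

definition fourier :: "('a::euclidean_space \<Rightarrow> complex) \<Rightarrow> 'a \<Rightarrow> complex" where
  "fourier F \<omega> = (LINT x|lebesgue. cis (- 2 * pi * (x \<bullet> \<omega>)) * F x)"

definition fourier_distr :: "'a::euclidean_space distr \<Rightarrow> 'a distr" where
  "fourier_distr u \<psi> = u (fourier \<psi>)"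


section \<open>Symplectic Fourier transform, Wigner and Born--Jordan distributions\<close>

fun symp :: "'a::euclidean_space \<times> 'a \<Rightarrow> 'a \<times> 'a \<Rightarrow> real" where
  "symp (x, \<omega>) (\<zeta>1, \<zeta>2) = \<omega> \<bullet> \<zeta>1 - x \<bullet> \<zeta>2"

definition symp_fourier ::
    "('a::euclidean_space \<times> 'a \<Rightarrow> complex) \<Rightarrow> 'a \<times> 'a \<Rightarrow> complex" where
  "symp_fourier F \<zeta> = (LINT z|lebesgue. cis (- 2 * pi * symp \<zeta> z) * F z)"

text \<open>The form \<open>symp\<close> is antisymmetric, so transposing the kernel of \<open>symp_fourier\<close> introduces a
  reflection: \<open>\<integral> symp_fourier F \<zeta> * \<psi> \<zeta> d\<zeta> = \<integral> F z * symp_fourier \<psi> (- z) dz\<close>.\<close>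

definition symp_fourier_distr :: "('a::euclidean_space \<times> 'a) distr \<Rightarrow> ('a \<times> 'a) distr" where
  "symp_fourier_distr u \<psi> = u (\<lambda>z. symp_fourier \<psi> (- z))"

fun wigner :: "('a::euclidean_space \<Rightarrow> complex) \<Rightarrow> 'a \<times> 'a \<Rightarrow> complex" where
  "wigner f (x, \<omega>) =
     (LINT y|lebesgue. f (x + y /\<^sub>R 2) * cnj (f (x - y /\<^sub>R 2)) * cis (- 2 * pi * (y \<bullet> \<omega>)))"

definition normalized_sinc :: "real \<Rightarrow> real" where
  "normalized_sinc t = (if t = 0 then 1 else sin (pi * t) / (pi * t))"

fun theta :: "nat \<Rightarrow> 'a::euclidean_space \<times> 'a \<Rightarrow> complex" where
  "theta n (x, \<omega>) = complex_of_real (normalized_sinc (x \<bullet> \<omega>) ^ n)"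

definition born_jordan ::
    "nat \<Rightarrow> ('a::euclidean_space \<Rightarrow> complex) \<Rightarrow> ('a \<times> 'a) distr" where
  "born_jordan n f =
     conv_distr (regular_distr (wigner f)) (symp_fourier_distr (regular_distr (theta n)))"


section \<open>The Sobolev wave-front set\<close>

definition japanese_bracket :: "'a::euclidean_space \<Rightarrow> real" where
  "japanese_bracket \<omega> = sqrt (1 + (norm \<omega>)\<^sup>2)"

definition open_conic_nhd :: "'a::euclidean_space \<Rightarrow> 'a set \<Rightarrow> bool" where
  "open_conic_nhd \<omega>0 \<Gamma> \<longleftrightarrow>
     open \<Gamma> \<and> \<Gamma> \<subseteq> UNIV - {0} \<and> \<omega>0 \<in> \<Gamma> \<and> (\<forall>\<omega>\<in>\<Gamma>. \<forall>t>0. t *\<^sub>R \<omega> \<in> \<Gamma>)"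

text \<open>Here \<open>g\<close> is the function (unique up to null sets) that the Fourier transform of the compactly
  supported distribution \<open>\<phi> u\<close> is.\<close>

definition sobolev_regular_at :: "real \<Rightarrow> 'a::euclidean_space distr \<Rightarrow> 'a \<Rightarrow> 'a \<Rightarrow> bool" where
  "sobolev_regular_at s u x0 \<omega>0 \<longleftrightarrow>
     (\<exists>\<phi> \<Gamma> g. smooth \<phi> \<and> compactly_supported \<phi> \<and> \<phi> x0 \<noteq> 0 \<and> open_conic_nhd \<omega>0 \<Gamma> \<and>
        represents g (fourier_distr (mult_distr \<phi> u)) \<and>
        (\<integral>\<^sup>+\<omega>\<in>\<Gamma>. ennreal ((norm (g \<omega>) * japanese_bracket \<omega> powr s)\<^sup>2) \<partial>lebesgue) < \<infinity>)"

definition sobolev_wave_front_set ::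
    "real \<Rightarrow> 'a::euclidean_space distr \<Rightarrow> ('a \<times> 'a) set" where
  "sobolev_wave_front_set s u = {(x0, \<omega>0). \<omega>0 \<noteq> 0 \<and> \<not> sobolev_regular_at s u x0 \<omega>0}"

end

theory Submission
  imports Defs "HOL-Probability.Characteristic_Functions" "HOL-Probability.Sinc_Integral"
begin

text \<open>For a bump function \<open>\<phi>\<close> the Fourier transform of \<open>\<phi> Q\<^sup>n f\<close> is, up to the symplectic rotation of
  the frequency variable, the convolution of the Fourier transform of \<open>\<phi>\<close> with \<open>\<Theta>\<^sup>n A\<close>, where the
  ambiguity function \<open>A\<close> of \<open>f\<close> is square integrable. On a cone where \<open>\<bar>\<omega>\<^sub>1 \<bullet> \<omega>\<^sub>2\<bar> \<ge> c \<bar>\<omega>\<bar>\<^sup>2\<close>, the factor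
  \<open>\<Theta>\<^sup>n\<close> at frequency \<open>\<eta>\<close> is at most a constant times \<open>\<langle>\<omega>\<rangle>\<^sup>-\<^sup>2\<^sup>n \<langle>\<omega> - \<eta>\<rangle>\<^sup>2\<^sup>n\<close>, and the growth in \<open>\<omega> - \<eta>\<close> is absorbed by the rapid
  decay of the Fourier transform of \<open>\<phi>\<close>. Hence the weighted transform is dominated on the cone by the
  convolution of an integrable with a square integrable function. Only the inequality in
  Plancherel's theorem is needed, together with Parseval's formula in one half of the variables.\<close>

section \<open>Lebesgue measure\<close>

text \<open>The product q of the two halves of a frequency is quadratic, and each factor sinc is
  worth one power of 1/|q|: this is why n factors gain 2n derivatives in directions where q does not
  vanish. Localising by \<phi> blurs the frequency, so the gain must survive a shift by h, which
  changes q by terms of size |h||\<omega>| and |h|^2. The mixed term is absorbed into c|\<omega>|^2.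
  The obstacle is that W and A are square integrable but in general not integrable, so the identity
  F_sigma W = A is not an absolutely convergent integral. Both are, however, partial Fourier
  transforms of one function, f(p + y/2) conj(f(p - y/2)): W in y for fixed p, A in p for fixed y,
  and this function is integrable in each variable separately. The identity is therefore proved
  weakly, tested against a continuous decaying function Z: Parseval in the second half of the
  variables trades W for the kernel, after which Fubini applies.\<close>

lemma nn_integral_lborel_affine:
  fixes f :: "'a::euclidean_space \<Rightarrow> ennreal"
  assumes [measurable]: "f \<in> borel_measurable borel" and c: "c \<noteq> 0"
  shows "(\<integral>\<^sup>+x. f x \<partial>lborel) = ennreal (\<bar>c\<bar> ^ DIM('a)) * (\<integral>\<^sup>+x. f (t + c *\<^sub>R x) \<partial>lborel)"
  by (subst lborel_affine[OF c, of t])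
     (simp add: nn_integral_density nn_integral_distr nn_integral_cmult ennreal_power)

lemma integrable_lborel_affine:
  fixes f :: "'a::euclidean_space \<Rightarrow> 'b::{banach, second_countable_topology}"
  assumes f: "integrable lborel f" and c: "c \<noteq> 0"
  shows "integrable lborel (\<lambda>x. f (t + c *\<^sub>R x))"
proof -
  have [measurable]: "f \<in> borel_measurable borel"
    using f by auto
  have "(\<integral>\<^sup>+x. norm (f x) \<partial>lborel) = ennreal (\<bar>c\<bar> ^ DIM('a)) * (\<integral>\<^sup>+x. norm (f (t + c *\<^sub>R x)) \<partial>lborel)"
    by (rule nn_integral_lborel_affine[where f="\<lambda>x. ennreal (norm (f x))"]) (use c in auto)
  with f show ?thesis
    unfolding integrable_iff_bounded using c by (auto simp: ennreal_mult_less_top)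
qed

lemma integral_lborel_affine:
  fixes f :: "'a::euclidean_space \<Rightarrow> 'b::{banach, second_countable_topology}"
  assumes [measurable]: "f \<in> borel_measurable borel" and c: "c \<noteq> 0"
  shows "(\<integral>x. f x \<partial>lborel) = \<bar>c\<bar> ^ DIM('a) *\<^sub>R (\<integral>x. f (t + c *\<^sub>R x) \<partial>lborel)"
proof -
  have "(\<integral>x. f x \<partial>lborel) =
    (\<integral>x. f x \<partial>density (distr lborel borel (\<lambda>x. t + c *\<^sub>R x)) (\<lambda>_. ennreal (\<bar>c\<bar> ^ DIM('a))))"
    by (subst lborel_affine[OF c, of t]) (simp add: ennreal_power)
  also have "\<dots> = (\<integral>x. \<bar>c\<bar> ^ DIM('a) *\<^sub>R f x \<partial>distr lborel borel (\<lambda>x. t + c *\<^sub>R x))"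
    by (subst integral_density) auto
  also have "\<dots> = (\<integral>x. \<bar>c\<bar> ^ DIM('a) *\<^sub>R f (t + c *\<^sub>R x) \<partial>lborel)"
    by (subst integral_distr) auto
  finally show ?thesis by simp
qed

lemma nn_integral_lborel_shift:
  fixes f :: "'a::euclidean_space \<Rightarrow> ennreal"
  assumes "f \<in> borel_measurable borel"
  shows "(\<integral>\<^sup>+x. f (x + a) \<partial>lborel) = (\<integral>\<^sup>+x. f x \<partial>lborel)"
  using nn_integral_lborel_affine[OF assms, of 1 a] by (simp add: add.commute)

lemma nn_integral_lborel_reflect:
  fixes f :: "'a::euclidean_space \<Rightarrow> ennreal"
  assumes "f \<in> borel_measurable borel"
  shows "(\<integral>\<^sup>+x. f (a - x) \<partial>lborel) = (\<integral>\<^sup>+x. f x \<partial>lborel)"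
  using nn_integral_lborel_affine[OF assms, of "-1" a] by simp

lemma integrable_lborel_shift:
  fixes f :: "'a::euclidean_space \<Rightarrow> 'b::{banach, second_countable_topology}"
  assumes "integrable lborel f"
  shows "integrable lborel (\<lambda>x. f (x + a))"
  using integrable_lborel_affine[OF assms, of 1 a] by (simp add: add.commute)

lemma integral_lborel_shift:
  fixes f :: "'a::euclidean_space \<Rightarrow> 'b::{banach, second_countable_topology}"
  assumes "f \<in> borel_measurable borel"
  shows "(\<integral>x. f (x + a) \<partial>lborel) = (\<integral>x. f x \<partial>lborel)"
  using integral_lborel_affine[OF assms, of 1 a] by (simp add: add.commute)

lemma integral_lborel_reflect:
  fixes f :: "'a::euclidean_space \<Rightarrow> 'b::{banach, second_countable_topology}"
  assumes "f \<in> borel_measurable borel"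
  shows "(\<integral>x. f (a - x) \<partial>lborel) = (\<integral>x. f x \<partial>lborel)"
  using integral_lborel_affine[OF assms, of "-1" a] by simp

lemma integrable_lborel_prod_bound:
  fixes k :: "'a::euclidean_space \<times> 'b::euclidean_space \<Rightarrow> 'c::{banach, second_countable_topology}"
  assumes [measurable]: "k \<in> borel_measurable borel"
    and u: "integrable lborel u" and v: "integrable lborel v"
    and le: "\<And>x y. norm (k (x, y)) \<le> u x * v y"
  shows "integrable (lborel \<Otimes>\<^sub>M lborel) k"
proof (rule Bochner_Integration.integrable_bound)
  show "integrable (lborel \<Otimes>\<^sub>M lborel) (\<lambda>(x, y). u x * v y :: real)"
    by (rule lborel_pair.Fubini_integrable) (use u v in \<open>auto simp: abs_mult\<close>)
  show "k \<in> borel_measurable (lborel \<Otimes>\<^sub>M lborel)"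
    by (simp add: lborel_prod)
  show "AE z in lborel \<Otimes>\<^sub>M lborel. norm (k z) \<le> norm (case z of (x, y) \<Rightarrow> u x * v y)"
    by (intro always_eventually allI) (auto intro!: order_trans[OF le])
qed

lemma borel_measurable_cis [measurable]:
  assumes [measurable]: "f \<in> borel_measurable M"
  shows "(\<lambda>x. cis (f x)) \<in> borel_measurable M"
  unfolding cis_conv_exp by measurable

section \<open>The Fourier transform of integrable functions\<close>

text \<open>\<open>fourier\<close> integrates over \<open>lebesgue\<close>, while Fubini and the
  substitutions are carried out over \<open>lborel\<close>. For Borel integrands passing to the
  completion does not change the integral.\<close>

lemma fourier_lborel:
  assumes "h \<in> borel_measurable borel"
  shows "fourier h \<omega> = (\<integral>x. cis (- 2 * pi * (x \<bullet> \<omega>)) * h x \<partial>lborel)"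
  unfolding fourier_def by (rule integral_completion) (use assms in measurable)

lemma fourier_measurable [measurable]:
  fixes h :: "'a::euclidean_space \<Rightarrow> complex"
  assumes [measurable]: "h \<in> borel_measurable borel"
  shows "fourier h \<in> borel_measurable borel"
proof -
  have "fourier h = (\<lambda>\<omega>. \<integral>x. cis (- 2 * pi * (x \<bullet> \<omega>)) * h x \<partial>lborel)"
    by (intro ext fourier_lborel) simp
  also have "\<dots> \<in> borel_measurable borel"
    by measurable
  finally show ?thesis .
qed

lemma integrable_cis_mult:
  fixes h :: "'a::euclidean_space \<Rightarrow> complex"
  assumes "integrable lborel h" and [measurable]: "g \<in> borel_measurable borel"
  shows "integrable lborel (\<lambda>x. cis (g x) * h x)"
  by (rule Bochner_Integration.integrable_bound[OF assms(1)])
     (use assms in \<open>auto simp: norm_mult\<close>)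

lemma norm_fourier_le:
  fixes h :: "'a::euclidean_space \<Rightarrow> complex"
  assumes "integrable lborel h"
  shows "norm (fourier h \<omega>) \<le> (\<integral>x. norm (h x) \<partial>lborel)"
proof -
  have "norm (fourier h \<omega>) \<le> (\<integral>x. norm (cis (- 2 * pi * (x \<bullet> \<omega>)) * h x) \<partial>lborel)"
    using assms by (subst fourier_lborel) auto
  then show ?thesis by (simp add: norm_mult)
qed

lemma continuous_fourier:
  fixes h :: "'a::euclidean_space \<Rightarrow> complex"
  assumes "integrable lborel h"
  shows "isCont (fourier h) \<omega>"
  unfolding continuous_at_sequentially comp_def
proof (intro allI impI)
  fix X assume X: "X \<longlonglongrightarrow> \<omega>"
  have [measurable]: "h \<in> borel_measurable borel" using assms by auto
  have "(\<lambda>n. \<integral>x. cis (- 2 * pi * (x \<bullet> X n)) * h x \<partial>lborel)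
      \<longlonglongrightarrow> (\<integral>x. cis (- 2 * pi * (x \<bullet> \<omega>)) * h x \<partial>lborel)"
    by (rule integral_dominated_convergence[where w="\<lambda>x. norm (h x)"])
       (use assms X in \<open>auto intro!: tendsto_intros simp: norm_mult\<close>)
  then show "(\<lambda>n. fourier h (X n)) \<longlonglongrightarrow> fourier h \<omega>"
    by (simp add: fourier_lborel)
qed

text \<open>The exponential kernel is symmetric in its two arguments and has modulus one, so the
  double integral is dominated by a product of integrable functions and Fubini exchanges the roles
  of \<open>u\<close> and \<open>v\<close>.\<close>

lemma fourier_multiplication:
  fixes u v :: "'a::euclidean_space \<Rightarrow> complex"
  assumes u: "integrable lborel u" and v: "integrable lborel v"
  shows "(\<integral>x. fourier u x * v x \<partial>lborel) = (\<integral>x. u x * fourier v x \<partial>lborel)"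
proof -
  have [measurable]: "u \<in> borel_measurable borel" "v \<in> borel_measurable borel"
    using u v by auto
  have "integrable (lborel \<Otimes>\<^sub>M lborel) (\<lambda>(x, y). cis (- 2 * pi * (y \<bullet> x)) * u y * v x)"
    by (rule integrable_lborel_prod_bound[where u="\<lambda>x. norm (v x)" and v="\<lambda>y. norm (u y)"])
       (use u v in \<open>auto simp: norm_mult borel_prod[symmetric]\<close>)
  from lborel_pair.Fubini_integral[OF this]
  have "(\<integral>x. \<integral>y. cis (- 2 * pi * (y \<bullet> x)) * u y * v x \<partial>lborel \<partial>lborel) =
     (\<integral>y. \<integral>x. u y * (cis (- 2 * pi * (x \<bullet> y)) * v x) \<partial>lborel \<partial>lborel)"
    by (simp add: inner_commute mult_ac)
  then show ?thesis
    by (simp add: fourier_lborel)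
qed

section \<open>Gaussians as regularising factors\<close>

definition gauss :: "'a::euclidean_space \<Rightarrow> real" where
  "gauss x = exp (- pi * (norm x)\<^sup>2)"

lemma gauss_measurable [measurable]: "gauss \<in> borel_measurable borel"
  unfolding gauss_def[abs_def] by measurable

lemma gauss_nonneg [simp]: "0 \<le> gauss x"
  by (simp add: gauss_def)

lemma gauss_minus [simp]: "gauss (- x) = gauss x"
  by (simp add: gauss_def)

lemma gauss_le_1 [simp]: "gauss x \<le> 1"
  by (simp add: gauss_def)

lemma gauss_real:
  fixes t :: real
  shows "integrable lborel (\<lambda>x. complex_of_real (exp (- pi * x\<^sup>2)))"
    and "(\<integral>x. cis (- 2 * pi * (x * t)) * complex_of_real (exp (- pi * x\<^sup>2)) \<partial>lborel)
      = complex_of_real (exp (- pi * t\<^sup>2))"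
proof -
  \<comment> \<open>Substituting s * x turns the exponent - x^2 / 2 of the normal density into - pi
    * x^2, and the Jacobian s cancels the normalising factor 1 / sqrt (2 * pi). The transform is
    then read off from the characteristic function of the normal distribution.\<close>
  define s where "s = sqrt (2 * pi)"
  have s: "s > 0" "s * s = 2 * pi" by (auto simp: s_def)
  have e: "std_normal_density (s * x) * s = exp (- pi * x\<^sup>2)" for x
  proof -
    have "(s * x)\<^sup>2 / 2 = pi * x\<^sup>2"
      using s by (simp add: power2_eq_square)
    then show ?thesis
      using s(1) unfolding std_normal_density_def s_def[symmetric] by simp
  qed
  have "integrable lborel (\<lambda>x. std_normal_density (0 + s * x))"
    by (rule lborel_integrable_real_affine) (use s in auto)
  then have "integrable lborel (\<lambda>x. std_normal_density (0 + s * x) * s)"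
    by (rule integrable_mult_left)
  then show "integrable lborel (\<lambda>x. complex_of_real (exp (- pi * x\<^sup>2)))"
    by (simp add: e)
  have "char std_normal_distribution (- s * t) =
    (\<integral>x. cis (- s * t * x) * of_real (std_normal_density x) \<partial>lborel)"
    unfolding char_def
    by (subst integral_density)
       (auto simp: normal_density_nonneg cis_conv_exp scaleR_conv_of_real mult_ac)
  also have "\<dots> = \<bar>s\<bar> *\<^sub>R (\<integral>x. cis (- s * t * (0 + s * x)) * of_real (std_normal_density (0 + s * x)) \<partial>lborel)"
    by (rule lborel_integral_real_affine) (use s in auto)
  also have "\<dots> = (\<integral>x. cis (- (s * s) * (x * t)) * of_real (std_normal_density (s * x) * s) \<partial>lborel)"
    using s(1) by (simp add: scaleR_conv_of_real mult_ac flip: integral_mult_right_zero)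
  also have "\<dots> = (\<integral>x. cis (- 2 * pi * (x * t)) * complex_of_real (exp (- pi * x\<^sup>2)) \<partial>lborel)"
    unfolding e s by simp
  also have "char std_normal_distribution (- s * t) = exp (- pi * t\<^sup>2)"
    unfolding char_std_normal_distribution
    using s by (simp add: power2_eq_square algebra_simps) 
  finally show "(\<integral>x. cis (- 2 * pi * (x * t)) * complex_of_real (exp (- pi * x\<^sup>2)) \<partial>lborel)
      = complex_of_real (exp (- pi * t\<^sup>2))" by simp
qed

text \<open>\<open>lborel\<close> is the image of the product of one-dimensional Lebesgue measures
  over \<open>Basis\<close>, so integrals of tensor products factor. This serves the Gaussian
  transform and, later, the integrability of inverse powers of \<open>weight\<close>.\<close>

lemma lborel_prod_coordinates:
  fixes f :: "'a::euclidean_space \<Rightarrow> real \<Rightarrow> 'b::{real_normed_field, banach, second_countable_topology}"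
  assumes f: "\<And>b. b \<in> Basis \<Longrightarrow> integrable lborel (f b)"
  shows "integrable lborel (\<lambda>x. \<Prod>b\<in>Basis. f b (x \<bullet> b))"
    and "(\<integral>x. (\<Prod>b\<in>Basis. f b (x \<bullet> b)) \<partial>lborel) = (\<Prod>b\<in>Basis. \<integral>x. f b x \<partial>lborel)"
proof -
  interpret product_sigma_finite "\<lambda>_::'a. lborel :: real measure" ..
  have [measurable]: "b \<in> Basis \<Longrightarrow> f b \<in> borel_measurable borel" for b
    using f[of b] by auto
  have *: "(\<Prod>b\<in>Basis. f b ((\<Sum>c\<in>Basis. g c *\<^sub>R c) \<bullet> b)) = (\<Prod>b\<in>Basis. f b (g b))" for g :: "'a \<Rightarrow> real"
    by (intro prod.cong) (auto simp: inner_sum_left inner_Basis if_distrib cong: if_cong)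
  show "integrable lborel (\<lambda>x. \<Prod>b\<in>Basis. f b (x \<bullet> b))"
    unfolding lborel_eq[where 'a='a]
    by (subst integrable_distr_eq) (auto simp: * intro!: product_integrable_prod f)
  show "(\<integral>x. (\<Prod>b\<in>Basis. f b (x \<bullet> b)) \<partial>lborel) = (\<Prod>b\<in>Basis. \<integral>x. f b x \<partial>lborel)"
    by (subst lborel_eq[where 'a='a], subst integral_distr) (auto simp: * intro!: product_integral_prod f)
qed

lemma gauss_prod: "gauss (x::'a::euclidean_space) = (\<Prod>b\<in>Basis. exp (- pi * (x \<bullet> b)\<^sup>2))"
proof -
  have "(norm x)\<^sup>2 = (\<Sum>b\<in>Basis. (x \<bullet> b)\<^sup>2)"
    unfolding power2_norm_eq_inner by (subst euclidean_inner) (simp add: power2_eq_square)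
  then show ?thesis
    by (simp add: gauss_def exp_sum[symmetric] sum_distrib_left)
qed

lemma cis_sum: "finite A \<Longrightarrow> cis (\<Sum>b\<in>A. f b) = (\<Prod>b\<in>A. cis (f b))"
  by (induction A rule: finite_induct) (auto simp: cis_mult[symmetric])

lemma integrable_gauss: "integrable lborel (\<lambda>x::'a::euclidean_space. complex_of_real (gauss x))"
  using lborel_prod_coordinates(1)[of "\<lambda>_::'a. \<lambda>x. complex_of_real (exp (- pi * x\<^sup>2))"] gauss_real(1)
  by (simp add: gauss_prod)

text \<open>Both the exponential and the Gaussian factor over the coordinates. The factor pi in
  \<open>gauss\<close> is chosen to make it its own transform; evaluating at 0 then shows that it
  has mass one.\<close>

lemma fourier_gauss:
  fixes \<omega> :: "'a::euclidean_space"
  shows "fourier (\<lambda>x. complex_of_real (gauss x)) \<omega> = gauss \<omega>"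
proof -
  have "cis (- 2 * pi * (x \<bullet> \<omega>)) * complex_of_real (gauss x) =
    (\<Prod>b\<in>Basis. cis (- 2 * pi * ((x \<bullet> b) * (\<omega> \<bullet> b))) * complex_of_real (exp (- pi * (x \<bullet> b)\<^sup>2)))" for x
    by (subst euclidean_inner) (simp add: gauss_prod sum_distrib_left cis_sum prod.distrib)
  then have "fourier (\<lambda>x. complex_of_real (gauss x)) \<omega> = (\<integral>x. (\<Prod>b\<in>Basis. cis (- 2 * pi * ((x \<bullet> b) * (\<omega> \<bullet> b))) * complex_of_real (exp (- pi * (x \<bullet> b)\<^sup>2))) \<partial>lborel)"
    by (subst fourier_lborel) auto
  also have "\<dots> = (\<Prod>b\<in>Basis. complex_of_real (exp (- pi * (\<omega> \<bullet> b)\<^sup>2)))"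
    by (subst lborel_prod_coordinates(2))
       (use gauss_real in \<open>auto intro!: integrable_cis_mult\<close>)
  finally show ?thesis
    by (simp add: gauss_prod)
qed

lemma integral_gauss: "(\<integral>x. gauss x \<partial>(lborel :: 'a::euclidean_space measure)) = 1"
proof -
  have "complex_of_real (\<integral>x. gauss x \<partial>(lborel :: 'a measure)) = 1"
    using fourier_gauss[of "0::'a"] by (simp add: fourier_lborel gauss_def)
  then show ?thesis by simp
qed

lemma fourier_gauss_scaled:
  fixes \<omega> :: "'a::euclidean_space" and k :: real
  assumes k: "k > 0"
  shows "fourier (\<lambda>x. complex_of_real (gauss (x /\<^sub>R k))) \<omega> = k ^ DIM('a) * gauss (k *\<^sub>R \<omega>)"
proof -
  have "fourier (\<lambda>x. complex_of_real (gauss (x /\<^sub>R k))) \<omega> =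
    (\<integral>x. cis (- 2 * pi * (x \<bullet> \<omega>)) * complex_of_real (gauss (x /\<^sub>R k)) \<partial>lborel)"
    by (subst fourier_lborel) auto
  also have "\<dots> = \<bar>k\<bar> ^ DIM('a) *\<^sub>R (\<integral>x. cis (- 2 * pi * ((0 + k *\<^sub>R x) \<bullet> \<omega>)) *
      complex_of_real (gauss ((0 + k *\<^sub>R x) /\<^sub>R k)) \<partial>lborel)"
    by (rule integral_lborel_affine) (use k in auto)
  also have "\<dots> = k ^ DIM('a) *\<^sub>R fourier (\<lambda>x. complex_of_real (gauss x)) (k *\<^sub>R \<omega>)"
    using k by (simp add: fourier_lborel)
  finally show ?thesis
    by (simp add: fourier_gauss scaleR_conv_of_real)
qed

lemma integrable_gauss_scaled:
  assumes "k > 0"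
  shows "integrable lborel (\<lambda>x::'a::euclidean_space. complex_of_real (gauss (x /\<^sub>R k)))"
  using integrable_lborel_affine[OF integrable_gauss, of "inverse k" 0] assms by simp

lemma nn_integral_gauss: "(\<integral>\<^sup>+x. gauss x \<partial>(lborel :: 'a::euclidean_space measure)) = 1"
proof -
  have "integrable (lborel :: 'a measure) gauss"
    using integrable_gauss by (simp only: complex_of_real_integrable_eq)
  then show ?thesis
    by (subst nn_integral_eq_integral) (auto simp: integral_gauss)
qed

lemma nn_integral_gauss_scaled:
  fixes y :: "'a::euclidean_space"
  assumes k: "k > 0"
  shows "(\<integral>\<^sup>+z. ennreal (k ^ DIM('a) * gauss (k *\<^sub>R (y - z))) \<partial>lborel) = 1"
proof -
  have "(\<integral>\<^sup>+z. ennreal (gauss z) \<partial>(lborel :: 'a measure)) =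
    ennreal (\<bar>- k\<bar> ^ DIM('a)) * (\<integral>\<^sup>+z. ennreal (gauss (k *\<^sub>R y + (- k) *\<^sub>R z)) \<partial>lborel)"
    by (rule nn_integral_lborel_affine) (use k in auto)
  also have "\<dots> = (\<integral>\<^sup>+z. ennreal (k ^ DIM('a) * gauss (k *\<^sub>R (y - z))) \<partial>lborel)"
    using k by (simp add: ennreal_mult nn_integral_cmult algebra_simps)
  finally show ?thesis
    by (simp add: nn_integral_gauss)
qed

text \<open>The product of the two transforms is bounded but perhaps not integrable; the Gaussian
  makes it so. The multiplication formula moves one transform off \<open>h\<close>, and a second use
  of it moves the other off \<open>H\<close>, leaving \<open>H\<close> averaged by a scaled
  Gaussian. Taking \<open>H\<close> to be the conjugate of \<open>h\<close> leads to the Plancherel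
  inequality, a general \<open>H\<close> to Parseval.\<close>

lemma fourier_pairing_gauss:
  fixes h H :: "'a::euclidean_space \<Rightarrow> complex" and k :: real
  assumes h: "integrable lborel h" and H: "integrable lborel H" and k: "k > 0"
  shows "(\<integral>x. fourier h x * (fourier H (- x) * gauss (x /\<^sub>R k)) \<partial>lborel) =
    (\<integral>y. h y * (\<integral>z. H z * complex_of_real (k ^ DIM('a) * gauss (k *\<^sub>R (y - z))) \<partial>lborel) \<partial>lborel)"
    and "integrable lborel (\<lambda>x. fourier h x * (fourier H (- x) * gauss (x /\<^sub>R k)))"
proof -
  have [measurable]: "h \<in> borel_measurable borel" "H \<in> borel_measurable borel"
    using h H by auto
  define v where "v x = fourier H (- x) * complex_of_real (gauss (x /\<^sub>R k))" for x
  \<comment> \<open>Reflecting the integral for \<open>fourier v y\<close> removes the minus sign in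
    \<open>fourier H (- x)\<close> and leaves the Gaussian modulated by \<open>y\<close>, which is
    \<open>w y\<close>. Its transform is the scaled Gaussian centred at \<open>y\<close>.\<close>
  define w where "w y x = cis (2 * pi * (x \<bullet> y)) * complex_of_real (gauss (x /\<^sub>R k))" for y x :: 'a
  have [measurable]: "v \<in> borel_measurable borel" "w y \<in> borel_measurable borel" for y
    unfolding v_def[abs_def] w_def[abs_def] by measurable
  have g: "integrable lborel (\<lambda>x::'a. complex_of_real (gauss (x /\<^sub>R k)))"
    using k by (rule integrable_gauss_scaled)
  then have w: "integrable lborel (w y)" for y
    unfolding w_def[abs_def] by (rule integrable_cis_mult) simp
  define B where "B = (\<integral>x. norm (H x) \<partial>lborel)"
  have HB: "norm (fourier H x) \<le> B" for x
    unfolding B_def by (rule norm_fourier_le[OF H])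
  have v: "integrable lborel v"
    by (rule Bochner_Integration.integrable_bound[OF integrable_mult_right[OF g, of B]])
       (auto simp: v_def norm_mult intro!: mult_right_mono order_trans[OF HB])
  define B' where "B' = (\<integral>x. norm (h x) \<partial>lborel)"
  have hB: "norm (fourier h x) \<le> B'" for x
    unfolding B'_def by (rule norm_fourier_le[OF h])
  have "integrable lborel (\<lambda>x. fourier h x * v x)"
    by (rule Bochner_Integration.integrable_bound[OF integrable_mult_right[OF v, of B']])
       (auto simp: norm_mult intro!: mult_right_mono order_trans[OF hB])
  then show "integrable lborel (\<lambda>x. fourier h x * (fourier H (- x) * gauss (x /\<^sub>R k)))"
    by (simp add: v_def)
  have "fourier v y = (\<integral>z. H z * complex_of_real (k ^ DIM('a) * gauss (k *\<^sub>R (y - z))) \<partial>lborel)" for y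
  proof -
    have W: "fourier (w y) z = k ^ DIM('a) * gauss (k *\<^sub>R (y - z))" for z
    proof -
      have "fourier (w y) z = fourier (\<lambda>x. complex_of_real (gauss (x /\<^sub>R k))) (z - y)"
      proof -
        have "cis (- 2 * pi * (x \<bullet> z)) * w y x =
            cis (- 2 * pi * (x \<bullet> (z - y))) * complex_of_real (gauss (x /\<^sub>R k))" for x
          unfolding w_def mult.assoc[symmetric] cis_mult by (simp add: inner_diff_right algebra_simps)
        then show ?thesis by (simp add: fourier_lborel)
      qed
      also have "\<dots> = k ^ DIM('a) * gauss (- (k *\<^sub>R (y - z)))"
        by (subst fourier_gauss_scaled[OF k]) (simp add: algebra_simps)
      finally show ?thesis by simp
    qed
    have "fourier v y = (\<integral>x. cis (- 2 * pi * (x \<bullet> y)) * v x \<partial>lborel)"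
      by (rule fourier_lborel) simp
    also have "\<dots> = (\<integral>x. cis (- 2 * pi * ((0 - x) \<bullet> y)) * v (0 - x) \<partial>lborel)"
      by (rule integral_lborel_reflect[symmetric]) simp
    also have "\<dots> = (\<integral>x. fourier H x * w y x \<partial>lborel)"
      by (simp add: v_def w_def mult_ac)
    also have "\<dots> = (\<integral>z. H z * fourier (w y) z \<partial>lborel)"
      by (rule fourier_multiplication[OF H w])
    finally show ?thesis by (simp add: W)
  qed
  then show "(\<integral>x. fourier h x * (fourier H (- x) * gauss (x /\<^sub>R k)) \<partial>lborel) =
    (\<integral>y. h y * (\<integral>z. H z * complex_of_real (k ^ DIM('a) * gauss (k *\<^sub>R (y - z))) \<partial>lborel) \<partial>lborel)"
    using fourier_multiplication[OF h v] by (simp add: v_def)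
qed

section \<open>The Plancherel inequality and Parseval's formula\<close>

lemma norm_integral_le_nn_integral:
  fixes f :: "'a \<Rightarrow> 'b::{banach, second_countable_topology}"
  shows "ennreal (norm (\<integral>x. f x \<partial>M)) \<le> (\<integral>\<^sup>+x. norm (f x) \<partial>M)"
  by (cases "integrable M f") (auto simp: integral_norm_bound_ennreal not_integrable_integral_eq)

lemma borel_measurable_cnj [measurable]:
  assumes [measurable]: "f \<in> borel_measurable M"
  shows "(\<lambda>x. cnj (f x)) \<in> borel_measurable M"
  by (rule measurable_compose[OF assms borel_measurable_continuous_onI]) (intro continuous_intros)

text \<open>This turns the bilinear pairing \<open>fourier h x * fourier H (- x)\<close> into the
  squared modulus of \<open>fourier h x\<close> when \<open>H\<close> is the conjugate of
  \<open>h\<close>.\<close>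

lemma fourier_cnj:
  assumes "h \<in> borel_measurable borel"
  shows "fourier (\<lambda>x. cnj (h x)) (- \<omega>) = cnj (fourier h \<omega>)"
proof -
  have "fourier (\<lambda>x. cnj (h x)) (- \<omega>) = (\<integral>x. cnj (cis (- 2 * pi * (x \<bullet> \<omega>)) * h x) \<partial>lborel)"
    using assms by (subst fourier_lborel) (auto simp: cis_cnj)
  then show ?thesis
    using assms by (simp only: Bochner_Integration.integral_cnj[symmetric] fourier_lborel)
qed

lemma gauss_scaled_tendsto: "(\<lambda>k. gauss (x /\<^sub>R real (Suc k))) \<longlonglongrightarrow> 1"
proof -
  have "(\<lambda>k. gauss (inverse (real (Suc k)) *\<^sub>R x)) \<longlonglongrightarrow> exp (- pi * (norm (0 *\<^sub>R x))\<^sup>2)"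
    unfolding gauss_def by (intro tendsto_intros LIMSEQ_inverse_real_of_nat)
  then show ?thesis by simp
qed

text \<open>Gaussian regularisation turns the left-hand side into a quadratic form with a positive kernel of
  mass one, which Schur's test bounds by the right-hand side; Fatou's lemma removes the Gaussian.\<close>

lemma fourier_L2_bound:
  fixes h :: "'a::euclidean_space \<Rightarrow> complex"
  assumes h: "integrable lborel h"
  shows "(\<integral>\<^sup>+x. ennreal ((norm (fourier h x))\<^sup>2) \<partial>lborel) \<le> (\<integral>\<^sup>+x. ennreal ((norm (h x))\<^sup>2) \<partial>lborel)"
proof -
  have [measurable]: "h \<in> borel_measurable borel" using h by auto
  define I where "I = (\<integral>\<^sup>+x. ennreal ((norm (h x))\<^sup>2) \<partial>lborel)"
  have bound: "(\<integral>\<^sup>+x. ennreal ((norm (fourier h x))\<^sup>2 * gauss (x /\<^sub>R k)) \<partial>lborel) \<le> I"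
    if k: "k > 0" for k
  proof -
    define g where "g y z = k ^ DIM('a) * gauss (k *\<^sub>R (y - z))" for y z :: 'a
    have [measurable]: "(\<lambda>(y, z). g y z) \<in> borel_measurable (borel \<Otimes>\<^sub>M borel)"
      unfolding g_def by measurable
    have g0: "0 \<le> g y z" for y z using k by (simp add: g_def)
    have gint: "(\<integral>\<^sup>+z. ennreal (g y z) \<partial>lborel) = 1" for y
      unfolding g_def by (rule nn_integral_gauss_scaled[OF k])
    have gsym: "g y z = g z y" for y z
      using gauss_minus[of "k *\<^sub>R (y - z)"] by (simp add: g_def del: gauss_minus flip: scaleR_minus_right)
    have cnj: "integrable lborel (\<lambda>x. cnj (h x))" using h by simp
    have eq: "fourier h x * (fourier (\<lambda>x. cnj (h x)) (- x) * gauss (x /\<^sub>R k)) =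
        complex_of_real ((norm (fourier h x))\<^sup>2 * gauss (x /\<^sub>R k))" for x
      unfolding fourier_cnj[OF \<open>h \<in> borel_measurable borel\<close>] by (simp only: mult.assoc[symmetric] complex_norm_square[symmetric] of_real_mult of_real_power)
    note P = fourier_pairing_gauss[OF h cnj k, unfolded eq]
    have i: "integrable lborel (\<lambda>x. (norm (fourier h x))\<^sup>2 * gauss (x /\<^sub>R k))"
      using P(2) by (simp only: complex_of_real_integrable_eq)
    have "(\<integral>\<^sup>+x. ennreal ((norm (fourier h x))\<^sup>2 * gauss (x /\<^sub>R k)) \<partial>lborel) =
      ennreal (\<integral>x. (norm (fourier h x))\<^sup>2 * gauss (x /\<^sub>R k) \<partial>lborel)"
      using i by (intro nn_integral_eq_integral) auto
    also have "\<dots> \<le> ennreal (norm (\<integral>x. complex_of_real ((norm (fourier h x))\<^sup>2 * gauss (x /\<^sub>R k)) \<partial>lborel))"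
      by (subst integral_complex_of_real) (auto intro!: ennreal_leI simp del: of_real_mult)
    also have "\<dots> = ennreal (norm (\<integral>y. h y * (\<integral>z. cnj (h z) * complex_of_real (g y z) \<partial>lborel) \<partial>lborel))"
      unfolding P(1) g_def ..
    also have "\<dots> \<le> (\<integral>\<^sup>+y. norm (h y * (\<integral>z. cnj (h z) * complex_of_real (g y z) \<partial>lborel)) \<partial>lborel)"
      by (rule norm_integral_le_nn_integral)
    also have "\<dots> \<le> (\<integral>\<^sup>+y. \<integral>\<^sup>+z. ennreal (norm (h y) * (norm (h z) * g y z)) \<partial>lborel \<partial>lborel)"
    proof (intro nn_integral_mono)
      fix y
      have "ennreal (norm (\<integral>z. cnj (h z) * complex_of_real (g y z) \<partial>lborel)) \<le>
        (\<integral>\<^sup>+z. ennreal (norm (h z) * g y z) \<partial>lborel)"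
        using norm_integral_le_nn_integral[of lborel "\<lambda>z. cnj (h z) * complex_of_real (g y z)"] g0
        by (simp add: norm_mult)
      then have "ennreal (norm (h y)) * ennreal (norm (\<integral>z. cnj (h z) * complex_of_real (g y z) \<partial>lborel)) \<le>
        ennreal (norm (h y)) * (\<integral>\<^sup>+z. ennreal (norm (h z) * g y z) \<partial>lborel)"
        by (rule mult_left_mono) simp
      then show "ennreal (norm (h y * (\<integral>z. cnj (h z) * complex_of_real (g y z) \<partial>lborel))) \<le>
         (\<integral>\<^sup>+z. ennreal (norm (h y) * (norm (h z) * g y z)) \<partial>lborel)"
        using g0 by (simp add: norm_mult ennreal_mult nn_integral_cmult)
    qed
    also have "\<dots> \<le> (\<integral>\<^sup>+y. \<integral>\<^sup>+z. ennreal ((norm (h y))\<^sup>2 / 2) * ennreal (g y z) + ennreal ((norm (h z))\<^sup>2 / 2) * ennreal (g y z) \<partial>lborel \<partial>lborel)"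
    proof (intro nn_integral_mono)
      fix y z
      \<comment> \<open>The inequality ab \<le> a^2 / 2 + b^2 / 2 separates the two values of
        \<open>h\<close>. Since \<open>g\<close> is symmetric with mass one in each variable, either
        summand integrates to half of \<open>I\<close>.\<close>
      have "0 \<le> (norm (h y) - norm (h z))\<^sup>2" by simp
      then have "norm (h y) * norm (h z) \<le> (norm (h y))\<^sup>2 / 2 + (norm (h z))\<^sup>2 / 2"
        by (simp add: power2_diff)
      from mult_right_mono[OF this g0[of y z]]
      show "ennreal (norm (h y) * (norm (h z) * g y z)) \<le> ennreal ((norm (h y))\<^sup>2 / 2) * ennreal (g y z) + ennreal ((norm (h z))\<^sup>2 / 2) * ennreal (g y z)"
        by (simp add: g0 algebra_simps flip: ennreal_mult ennreal_plus)
    qed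
    also have "\<dots> = (\<integral>\<^sup>+y. \<integral>\<^sup>+z. ennreal ((norm (h y))\<^sup>2 / 2) * ennreal (g y z) \<partial>lborel \<partial>lborel) +
       (\<integral>\<^sup>+y. \<integral>\<^sup>+z. ennreal ((norm (h z))\<^sup>2 / 2) * ennreal (g y z) \<partial>lborel \<partial>lborel)"
      by (subst nn_integral_add[symmetric]) (auto simp: nn_integral_add)
    also have "(\<integral>\<^sup>+y. \<integral>\<^sup>+z. ennreal ((norm (h z))\<^sup>2 / 2) * ennreal (g y z) \<partial>lborel \<partial>lborel) =
       (\<integral>\<^sup>+z. \<integral>\<^sup>+y. ennreal ((norm (h z))\<^sup>2 / 2) * ennreal (g z y) \<partial>lborel \<partial>lborel)"
      by (subst lborel_pair.Fubini') (auto simp: gsym)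
    also have "(\<integral>\<^sup>+y. \<integral>\<^sup>+z. ennreal ((norm (h y))\<^sup>2 / 2) * ennreal (g y z) \<partial>lborel \<partial>lborel) =
       (\<integral>\<^sup>+y. ennreal ((norm (h y))\<^sup>2 / 2) \<partial>lborel)"
      by (simp add: nn_integral_cmult gint)
    also have "(\<integral>\<^sup>+y. ennreal ((norm (h y))\<^sup>2 / 2) \<partial>lborel) + (\<integral>\<^sup>+y. ennreal ((norm (h y))\<^sup>2 / 2) \<partial>lborel) = I"
      unfolding I_def by (subst nn_integral_add[symmetric]) (auto simp flip: ennreal_plus)
    finally show ?thesis .
  qed
  have "(\<integral>\<^sup>+x. ennreal ((norm (fourier h x))\<^sup>2) \<partial>lborel) =
    (\<integral>\<^sup>+x. liminf (\<lambda>k. ennreal ((norm (fourier h x))\<^sup>2 * gauss (x /\<^sub>R real (Suc k)))) \<partial>lborel)"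
  proof (intro nn_integral_cong)
    fix x
    have "(\<lambda>k. ennreal ((norm (fourier h x))\<^sup>2 * gauss (x /\<^sub>R real (Suc k)))) \<longlonglongrightarrow> ennreal ((norm (fourier h x))\<^sup>2 * 1)"
      by (intro tendsto_ennrealI tendsto_intros gauss_scaled_tendsto)
    from lim_imp_Liminf[OF _ this] show "ennreal ((norm (fourier h x))\<^sup>2) = liminf (\<lambda>k. ennreal ((norm (fourier h x))\<^sup>2 * gauss (x /\<^sub>R real (Suc k))))"
      by simp
  qed
  also have "\<dots> \<le> liminf (\<lambda>k. \<integral>\<^sup>+x. ennreal ((norm (fourier h x))\<^sup>2 * gauss (x /\<^sub>R real (Suc k))) \<partial>lborel)"
    by (rule nn_integral_liminf) measurable
  also have "\<dots> \<le> liminf (\<lambda>k::nat. I)"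
    by (intro Liminf_mono always_eventually allI bound) simp
  finally show ?thesis
    by (simp add: Liminf_const I_def)
qed

text \<open>The Gaussian-regularised pairing is computed in two ways. On the frequency side the
  Gaussian tends to 1, with \<open>int\<close> providing the majorant; on the other side the
  averages of \<open>H\<close> tend to \<open>H\<close> by continuity, with the bound
  \<open>B\<close> providing one. Integrability is asked only of the product of the transforms,
  which is what square integrability of both factors can supply.\<close>

lemma fourier_parseval:
  fixes h H :: "'a::euclidean_space \<Rightarrow> complex"
  assumes h: "integrable lborel h" and H: "integrable lborel H"
    and B: "\<And>x. norm (H x) \<le> B" and cont: "\<And>x. isCont H x"
    and int: "integrable lborel (\<lambda>x. fourier h x * fourier H (- x))"
  shows "(\<integral>x. fourier h x * fourier H (- x) \<partial>lborel) = (\<integral>x. h x * H x \<partial>lborel)"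
proof (rule LIMSEQ_unique)
  have [measurable]: "h \<in> borel_measurable borel" "H \<in> borel_measurable borel"
    using h H by auto
  show "(\<lambda>k. \<integral>x. fourier h x * (fourier H (- x) * gauss (x /\<^sub>R real (Suc k))) \<partial>lborel)
    \<longlonglongrightarrow> (\<integral>x. fourier h x * fourier H (- x) \<partial>lborel)"
  proof (rule integral_dominated_convergence[where w="\<lambda>x. norm (fourier h x * fourier H (- x))"])
    show "AE x in lborel. (\<lambda>k. fourier h x * (fourier H (- x) * gauss (x /\<^sub>R real (Suc k))))
       \<longlonglongrightarrow> fourier h x * fourier H (- x)"
    proof (intro always_eventually allI)
      fix x
      have "(\<lambda>k. fourier h x * (fourier H (- x) * gauss (x /\<^sub>R real (Suc k))))
       \<longlonglongrightarrow> fourier h x * (fourier H (- x) * complex_of_real 1)"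
        by (intro tendsto_intros gauss_scaled_tendsto)
      then show "(\<lambda>k. fourier h x * (fourier H (- x) * gauss (x /\<^sub>R real (Suc k))))
       \<longlonglongrightarrow> fourier h x * fourier H (- x)" by simp
    qed
  qed (use integrable_norm[OF int] in \<open>auto simp: norm_mult intro!: mult_left_mono mult_left_le\<close>)
  have "(\<integral>x. fourier h x * (fourier H (- x) * gauss (x /\<^sub>R real (Suc k))) \<partial>lborel) =
     (\<integral>y. h y * (\<integral>u. H (y - u /\<^sub>R real (Suc k)) * gauss u \<partial>lborel) \<partial>lborel)" for k
  proof -
    define c where "c = real (Suc k)"
    have c: "c > 0" by (simp add: c_def)
    \<comment> \<open>Substituting z = y - u / c makes the Gaussian weight independent of
      \<open>c\<close>, so the limit only concerns the argument of \<open>H\<close>.\<close>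
    have *: "(\<integral>z. H z * complex_of_real (c ^ DIM('a) * gauss (c *\<^sub>R (y - z))) \<partial>lborel) =
      (\<integral>u. H (y - u /\<^sub>R c) * gauss u \<partial>lborel)" for y
    proof -
      have "(\<integral>z. H z * complex_of_real (c ^ DIM('a) * gauss (c *\<^sub>R (y - z))) \<partial>lborel) =
       \<bar>- inverse c\<bar> ^ DIM('a) *\<^sub>R (\<integral>u. H (y + (- inverse c) *\<^sub>R u) * complex_of_real (c ^ DIM('a) * gauss (c *\<^sub>R (y - (y + (- inverse c) *\<^sub>R u)))) \<partial>lborel)"
        by (rule integral_lborel_affine) (use c in auto)
      also have "\<dots> = (\<integral>u. (inverse c * c) ^ DIM('a) *\<^sub>R (H (y - u /\<^sub>R c) * gauss u) \<partial>lborel)"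
        using c unfolding power_mult_distrib
        by (subst integral_scaleR_right[symmetric]) (simp add: scaleR_conv_of_real mult_ac)
      finally show ?thesis using c by simp
    qed
    show ?thesis
      using fourier_pairing_gauss(1)[OF h H c] unfolding * unfolding c_def .
  qed
  moreover have "(\<lambda>k. \<integral>y. h y * (\<integral>u. H (y - u /\<^sub>R real (Suc k)) * gauss u \<partial>lborel) \<partial>lborel) \<longlonglongrightarrow> (\<integral>y. h y * H y \<partial>lborel)"
  proof (rule integral_dominated_convergence[where w="\<lambda>y. norm (h y) * B"])
    have ib: "integrable lborel (\<lambda>u::'a. B * gauss u)"
      using integrable_gauss[where 'a='a] unfolding complex_of_real_integrable_eq by simp
    show "AE y in lborel. (\<lambda>k. h y * (\<integral>u. H (y - u /\<^sub>R real (Suc k)) * gauss u \<partial>lborel)) \<longlonglongrightarrow> h y * H y"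
    proof (intro always_eventually allI tendsto_intros)
      fix y
      have "(\<lambda>k. \<integral>u. H (y - u /\<^sub>R real (Suc k)) * complex_of_real (gauss u) \<partial>lborel) \<longlonglongrightarrow> (\<integral>u. H y * complex_of_real (gauss u) \<partial>(lborel :: 'a measure))"
      proof (rule integral_dominated_convergence[where w="\<lambda>u::'a. B * gauss u"])
        show "AE u in lborel. (\<lambda>k. H (y - u /\<^sub>R real (Suc k)) * complex_of_real (gauss u)) \<longlonglongrightarrow> H y * complex_of_real (gauss u)"
        proof (intro always_eventually allI tendsto_intros)
          fix u
          have "(\<lambda>k. y - inverse (real (Suc k)) *\<^sub>R u) \<longlonglongrightarrow> y - 0 *\<^sub>R u"
            by (intro tendsto_intros LIMSEQ_inverse_real_of_nat)
          then show "(\<lambda>k. H (y - u /\<^sub>R real (Suc k))) \<longlonglongrightarrow> H y"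
            using cont[of y] by (intro isCont_tendsto_compose[of y H]) auto
        qed
      qed (use B ib in \<open>auto simp: norm_mult intro!: mult_right_mono\<close>)
      then show "(\<lambda>k. \<integral>u. H (y - u /\<^sub>R real (Suc k)) * complex_of_real (gauss u) \<partial>lborel) \<longlonglongrightarrow> H y"
        by (simp add: integral_gauss)
    qed
    show "AE y in lborel. norm (h y * (\<integral>u. H (y - u /\<^sub>R real (Suc k)) * gauss u \<partial>lborel)) \<le> norm (h y) * B" for k
    proof (intro always_eventually allI)
      fix y
      have B0: "0 \<le> B" using order_trans[OF norm_ge_zero B] .
      have "norm (\<integral>u. H (y - u /\<^sub>R real (Suc k)) * complex_of_real (gauss u) \<partial>lborel) \<le> (\<integral>u. B * gauss u \<partial>(lborel :: 'a measure))"
        by (rule Bochner_Integration.integral_norm_bound_integral[OF _ ib])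
           (use B B0 in \<open>auto simp: norm_mult abs_mult intro!: AE_I2 mult_right_mono Bochner_Integration.integrable_bound[OF ib]\<close>)
      then show "norm (h y * (\<integral>u. H (y - u /\<^sub>R real (Suc k)) * gauss u \<partial>lborel)) \<le> norm (h y) * B"
        by (simp add: norm_mult integral_gauss mult_left_mono)
    qed
  qed (use h in auto)
  ultimately show "(\<lambda>k. \<integral>x. fourier h x * (fourier H (- x) * gauss (x /\<^sub>R real (Suc k))) \<partial>lborel)
    \<longlonglongrightarrow> (\<integral>x. h x * H x \<partial>lborel)" by simp
qed

section \<open>Bump functions\<close>

text \<open>The classical flat function exp (- 1 / t), with the powers of 1 / t that its derivatives
  produce: each derivative of a member is a linear combination of members.\<close>

definition flat_exp :: "nat \<Rightarrow> real \<Rightarrow> real" where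
  "flat_exp k t = (if 0 < t then exp (- inverse t) * inverse t ^ k else 0)"

text \<open>With s = 1 / t, the inequality x \<le> exp x at s / (k + 1), raised to the power k + 1,
  bounds exp (- s) * s^(k + 1). The one power of s beyond k supplies the factor t, so every member
  vanishes continuously at 0.\<close>

lemma flat_exp_bound: "\<bar>flat_exp k t\<bar> \<le> real (Suc k) ^ Suc k * \<bar>t\<bar>"
proof (cases "0 < t")
  case True
  define s where "s = inverse t"
  have s: "s > 0" "t * s = 1" using True by (auto simp: s_def)
  have "(s / Suc k) ^ Suc k \<le> exp (s / Suc k) ^ Suc k"
  proof (rule power_mono)
    show "s / Suc k \<le> exp (s / Suc k)"
      using exp_ge_add_one_self[of "s / Suc k"] by linarith
  qed (use s in auto)
  also have "\<dots> = exp s"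
    by (simp add: exp_of_nat_mult[symmetric] del: power_Suc)
  finally have "s ^ Suc k \<le> real (Suc k) ^ Suc k * exp s"
    by (simp add: power_divide field_simps del: power_Suc)
  then have "exp (- s) * s ^ Suc k \<le> real (Suc k) ^ Suc k"
    by (simp add: exp_minus field_simps del: power_Suc)
  then have "t * (exp (- s) * s ^ Suc k) \<le> t * real (Suc k) ^ Suc k"
    using True by (intro mult_left_mono) auto
  also have "t * (exp (- s) * s ^ Suc k) = (t * s) * (exp (- s) * s ^ k)"
    by (simp only: power_Suc mult_ac)
  finally have "exp (- s) * s ^ k \<le> t * real (Suc k) ^ Suc k"
    by (simp only: s mult_1)
  then show ?thesis
    using True s by (simp add: flat_exp_def s_def[symmetric] mult.commute del: power_Suc)
next
  case False
  have "0 \<le> real (Suc k) ^ Suc k * \<bar>t\<bar>"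
    by (intro mult_nonneg_nonneg) auto
  with False show ?thesis by (simp add: flat_exp_def del: power_Suc)
qed

lemma flat_exp_deriv:
  "(flat_exp k has_real_derivative flat_exp (Suc (Suc k)) t - real k * flat_exp (Suc k) t) (at t)"
proof -
  consider "t > 0" | "t < 0" | "t = 0" by linarith
  then show ?thesis
  proof cases
    case 1
    have "((\<lambda>t. exp (- inverse t) * inverse t ^ k) has_real_derivative
        flat_exp (Suc (Suc k)) t - real k * flat_exp (Suc k) t) (at t)"
    proof -
      have "((\<lambda>s. exp (- s) * s ^ k) has_real_derivative
          - exp (- s) * s ^ k + exp (- s) * (real k * s ^ (k - 1))) (at s)" for s :: real
        by (auto intro!: derivative_eq_intros)
      moreover have "(inverse has_real_derivative - (inverse t * inverse t)) (at t)"
        using 1 DERIV_inverse[of t] by (simp add: power2_eq_square)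
      ultimately have "((\<lambda>t. exp (- inverse t) * inverse t ^ k) has_real_derivative
          (- exp (- inverse t) * inverse t ^ k + exp (- inverse t) * (real k * inverse t ^ (k - 1)))
            * (- (inverse t * inverse t))) (at t)"
        by (rule DERIV_chain2)
      \<comment> \<open>The exponent \<open>k - 1\<close> is truncated at 0; there the factor
        \<open>real k\<close> removes the term, and otherwise the two powers from the derivative of
        \<open>inverse\<close> raise it to \<open>k + 1\<close>.\<close>
      then show ?thesis
        using 1 by (cases k) (simp_all add: flat_exp_def algebra_simps)
    qed
    then show ?thesis
      by (rule has_field_derivative_transform_within_open[where S="{0<..}"])
         (use 1 in \<open>auto simp: flat_exp_def\<close>)
  next
    case 2
    have "((\<lambda>t. 0) has_real_derivative flat_exp (Suc (Suc k)) t - real k * flat_exp (Suc k) t) (at t)"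
      using 2 by (simp add: flat_exp_def)
    then show ?thesis
      by (rule has_field_derivative_transform_within_open[where S="{..<0}"])
         (use 2 in \<open>auto simp: flat_exp_def\<close>)
  next
    case 3
    have "((\<lambda>h. real (Suc (Suc k)) ^ Suc (Suc k) * \<bar>h\<bar>) \<longlongrightarrow> real (Suc (Suc k)) ^ Suc (Suc k) * \<bar>0\<bar>) (at (0::real))"
      by (intro tendsto_intros)
    then have "((\<lambda>h. real (Suc (Suc k)) ^ Suc (Suc k) * \<bar>h\<bar>) \<longlongrightarrow> 0) (at (0::real))"
      by simp
    then have "(flat_exp (Suc k) \<longlongrightarrow> 0) (at 0)"
      by (rule Lim_null_comparison[rotated]) (use flat_exp_bound[of "Suc k"] in auto)
    \<comment> \<open>At 0 the difference quotient of \<open>flat_exp k\<close> is itself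
      \<open>flat_exp (Suc k)\<close>, which has just been shown to tend to 0.\<close>
    then have "((\<lambda>h. (flat_exp k (0 + h) - flat_exp k 0) / h) \<longlongrightarrow> 0) (at 0)"
      by (rule Lim_transform_eventually)
         (auto simp: flat_exp_def eventually_at_filter divide_inverse mult_ac)
    then show ?thesis
      using 3 by (simp add: DERIV_def flat_exp_def)
  qed
qed

text \<open>The closure rules make the family stable under partial derivatives.\<close>

inductive_set bumps :: "'a::euclidean_space \<Rightarrow> ('a \<Rightarrow> complex) set" for c where
  flat: "(\<lambda>x. complex_of_real (flat_exp k (1 - (norm (x - c))\<^sup>2))) \<in> bumps c"
| add: "u \<in> bumps c \<Longrightarrow> v \<in> bumps c \<Longrightarrow> (\<lambda>x. u x + v x) \<in> bumps c"
| scale: "u \<in> bumps c \<Longrightarrow> (\<lambda>x. a * u x) \<in> bumps c"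
| coord: "u \<in> bumps c \<Longrightarrow> (\<lambda>x. complex_of_real (x \<bullet> b) * u x) \<in> bumps c"

lemma bumps_has_derivative:
  assumes "u \<in> bumps c"
  obtains D where "\<And>x. (u has_derivative D x) (at x)" "\<And>b. (\<lambda>x. D x b) \<in> bumps c"
proof -
  have "\<exists>D. (\<forall>x. (u has_derivative D x) (at x)) \<and> (\<forall>b. (\<lambda>x. D x b) \<in> bumps c)"
    using assms
  proof induction
    case (flat k)
    define r where "r x = 1 - (norm (x - c))\<^sup>2" for x
    define e where "e j x = complex_of_real (flat_exp j (r x))" for j x
    define D where "D x h = complex_of_real
      ((- 2 * ((x - c) \<bullet> h)) * (flat_exp (Suc (Suc k)) (r x) - real k * flat_exp (Suc k) (r x)))" for x h
    have "(r has_derivative (\<lambda>h. - 2 * ((x - c) \<bullet> h))) (at x)" for x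
      unfolding r_def power2_norm_eq_inner
      by (auto intro!: derivative_eq_intros simp: inner_commute)
    then have "((\<lambda>x. flat_exp k (r x)) has_derivative
       (\<lambda>h. (- 2 * ((x - c) \<bullet> h)) * (flat_exp (Suc (Suc k)) (r x) - real k * flat_exp (Suc k) (r x)))) (at x)" for x
      using has_derivative_compose[OF _ flat_exp_deriv[unfolded has_field_derivative_def]]
      by (fastforce simp: mult.commute)
    then have "(e k has_derivative D x) (at x)" for x
      unfolding e_def[abs_def] D_def[abs_def] by (rule has_derivative_of_real)
    moreover have "(\<lambda>x. D x b) \<in> bumps c" for b
    proof -
      define v where "v x = e (Suc (Suc k)) x + (- of_nat k) * e (Suc k) x" for x
      have "v \<in> bumps c"
        unfolding v_def e_def r_def by (intro bumps.intros)
      \<comment> \<open>The closure rules multiply by coordinates of \<open>x\<close>, not of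
        \<open>x - c\<close>, so the inner derivative is split into a coordinate and a
        constant.\<close>
      then have "(\<lambda>x. (- 2) * (of_real (x \<bullet> b) * v x) + 2 * of_real (c \<bullet> b) * v x) \<in> bumps c"
        by (intro bumps.intros)
      also have "(\<lambda>x. (- 2) * (of_real (x \<bullet> b) * v x) + 2 * of_real (c \<bullet> b) * v x) = (\<lambda>x. D x b)"
        by (auto simp: D_def v_def e_def inner_diff_left algebra_simps)
      finally show ?thesis .
    qed
    ultimately show ?case
      unfolding e_def r_def by blast
  next
    case (add u v)
    then obtain D E where D: "\<And>x. (u has_derivative D x) (at x)" "\<And>b. (\<lambda>x. D x b) \<in> bumps c"
      and E: "\<And>x. (v has_derivative E x) (at x)" "\<And>b. (\<lambda>x. E x b) \<in> bumps c" by blast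
    then have "((\<lambda>x. u x + v x) has_derivative (\<lambda>h. D x h + E x h)) (at x)" for x
      by (intro has_derivative_add)
    moreover have "(\<lambda>x. D x b + E x b) \<in> bumps c" for b
      using D E by (intro bumps.intros)
    ultimately show ?case by (intro exI[of _ "\<lambda>x h. D x h + E x h"]) blast
  next
    case (scale u a)
    then obtain D where D: "\<And>x. (u has_derivative D x) (at x)" "\<And>b. (\<lambda>x. D x b) \<in> bumps c" by blast
    then have "((\<lambda>x. a * u x) has_derivative (\<lambda>h. a * D x h)) (at x)" for x
      by (intro has_derivative_mult_right)
    moreover have "(\<lambda>x. a * D x b) \<in> bumps c" for b
      using D by (intro bumps.intros)
    ultimately show ?case by (intro exI[of _ "\<lambda>x h. a * D x h"]) blast
  next
    case (coord u b')
    then obtain D where D: "\<And>x. (u has_derivative D x) (at x)" "\<And>b. (\<lambda>x. D x b) \<in> bumps c" by blast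
    then have "((\<lambda>x. complex_of_real (x \<bullet> b') * u x) has_derivative
       (\<lambda>h. complex_of_real (x \<bullet> b') * D x h + complex_of_real (h \<bullet> b') * u x)) (at x)" for x
      by (auto intro!: derivative_eq_intros)
    moreover have "(\<lambda>x. complex_of_real (x \<bullet> b') * D x b + complex_of_real (b \<bullet> b') * u x) \<in> bumps c" for b
      using D coord by (intro bumps.intros)
    ultimately show ?case
      by (intro exI[of _ "\<lambda>x h. complex_of_real (x \<bullet> b') * D x h + complex_of_real (h \<bullet> b') * u x"]) blast
  qed
  then show thesis using that by blast
qed

lemma bumps_outside:
  assumes "u \<in> bumps c" "norm (x - c) \<ge> 1"
  shows "u x = 0"
  using assms
proof induction
  case (flat k)
  then have "1 \<le> (norm (x - c))\<^sup>2"
    by (simp add: one_le_power)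
  then show ?case by (simp add: flat_exp_def)
qed auto

lemma bumps_iter_deriv:
  assumes u: "u \<in> bumps c"
  shows "iter_deriv bs u \<in> bumps c"
proof (induction bs)
  case (Cons b bs)
  obtain D where D: "\<And>x. (iter_deriv bs u has_derivative D x) (at x)" "\<And>b. (\<lambda>x. D x b) \<in> bumps c"
    using bumps_has_derivative[OF Cons.IH] by blast
  then have "frechet_derivative (iter_deriv bs u) (at x) = D x" for x
    by (metis frechet_derivative_at)
  with D show ?case by simp
qed (simp add: u)

lemma bumps_smooth: "u \<in> bumps c \<Longrightarrow> smooth u"
  unfolding smooth_def differentiable_def
  by (metis bumps_has_derivative bumps_iter_deriv)

lemma bumps_compactly_supported:
  assumes "u \<in> bumps c"
  shows "compactly_supported u"
proof -
  have "{x. u x \<noteq> 0} \<subseteq> cball c 1"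
    using bumps_outside[OF assms] by (force simp: dist_norm norm_minus_commute)
  then have "bounded {x. u x \<noteq> 0}"
    by (rule bounded_subset[OF bounded_cball])
  then show ?thesis
    by (simp add: compactly_supported_def)
qed

lemma bumps_continuous: "u \<in> bumps c \<Longrightarrow> isCont u x"
  by (metis bumps_has_derivative has_derivative_continuous)

lemma bumps_measurable: "u \<in> bumps c \<Longrightarrow> u \<in> borel_measurable borel"
  by (intro borel_measurable_continuous_onI continuous_at_imp_continuous_on ballI bumps_continuous)

lemma bumps_bounded:
  assumes "u \<in> bumps c"
  obtains B where "\<And>x. norm (u x) \<le> B" "B \<ge> 0"
proof -
  have "compact (u ` cball c 1)"
    by (intro compact_continuous_image continuous_at_imp_continuous_on ballI bumps_continuous[OF assms]) simp
  then obtain B where B: "\<And>x. x \<in> cball c 1 \<Longrightarrow> norm (u x) \<le> B"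
    by (meson compact_imp_bounded bounded_iff imageI)
  have "norm (u x) \<le> max B 0" for x
    using B[of x] bumps_outside[OF assms, of x]
    by (cases "x \<in> cball c 1") (auto simp: dist_norm norm_minus_commute)
  then show thesis using that by (metis max.cobounded2)
qed

lemma integrable_bounded_support:
  fixes u :: "'a::euclidean_space \<Rightarrow> 'b::{banach, second_countable_topology}"
  assumes [measurable]: "u \<in> borel_measurable borel"
    and "\<And>x. norm (u x) \<le> B" "\<And>x. norm (x - c) > R \<Longrightarrow> u x = 0"
  shows "integrable lborel u"
proof (rule Bochner_Integration.integrable_bound)
  show "integrable lborel (\<lambda>x. indicator (cball c R) x *\<^sub>R B)"
    using emeasure_lborel_cball_finite[of c R]
    by (auto simp: less_top)
  show "AE x in lborel. norm (u x) \<le> norm (indicator (cball c R) x *\<^sub>R B)"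
    using assms(2,3) by (auto intro!: always_eventually simp: indicator_def dist_norm norm_minus_commute not_le
        intro: order_trans[OF _ abs_ge_self])
qed auto

lemma bumps_integrable:
  assumes "u \<in> bumps c"
  shows "integrable lborel u"
proof -
  obtain B where "\<And>x. norm (u x) \<le> B"
    using bumps_bounded[OF assms] by blast
  then show ?thesis
    by (rule integrable_bounded_support[OF bumps_measurable[OF assms], where c=c and R=1])
       (use bumps_outside[OF assms] in auto)
qed

text \<open>The difference quotients have integral zero and converge boundedly to the derivative.\<close>

lemma integral_derivative_compact_support:
  fixes w :: "'a::euclidean_space \<Rightarrow> complex"
  assumes D: "\<And>x. (w has_derivative D x) (at x)"
    and [measurable]: "(\<lambda>x. D x b) \<in> borel_measurable borel"
    and B: "\<And>x. norm (D x b) \<le> B"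
    and bound: "\<And>x. norm (w x) \<le> B'"
    and supp: "\<And>x. norm (x - c) > R \<Longrightarrow> w x = 0"
  shows "(\<integral>x. D x b \<partial>lborel) = 0"
proof -
  have cont: "isCont w x" for x
    by (rule has_derivative_continuous[OF D])
  then have [measurable]: "w \<in> borel_measurable borel"
    by (intro borel_measurable_continuous_onI continuous_at_imp_continuous_on) auto
  have w: "integrable lborel w"
    using bound supp by (rule integrable_bounded_support[rotated]) auto
  have vd: "((\<lambda>t. w (x + t *\<^sub>R b)) has_derivative (\<lambda>h. h *\<^sub>R D (x + t *\<^sub>R b) b)) (at t)" for x t
  proof -
    have "((\<lambda>t. w (x + t *\<^sub>R b)) has_derivative (\<lambda>h. D (x + t *\<^sub>R b) (h *\<^sub>R b))) (at t)"
      by (rule has_derivative_compose[OF _ D]) (auto intro!: derivative_eq_intros)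
    moreover have "D x (h *\<^sub>R b) = h *\<^sub>R D x b" for x h
      using has_derivative_linear[OF D[of x]] by (rule linear_scale)
    ultimately show ?thesis by simp
  qed
  define q where "q k x = of_nat (Suc k) * (w (x + b /\<^sub>R real (Suc k)) - w x)" for k x
  have q0: "(\<integral>x. q k x \<partial>lborel) = 0" for k
    using integrable_lborel_shift[OF w] integral_lborel_shift[of w] w by (simp add: q_def)
  have "(\<lambda>k. \<integral>x. q k x \<partial>lborel) \<longlonglongrightarrow> (\<integral>x. D x b \<partial>lborel)"
  proof (rule integral_dominated_convergence[where w="\<lambda>x. indicator (cball c (R + norm b)) x *\<^sub>R B"])
    show "AE x in lborel. (\<lambda>k. q k x) \<longlonglongrightarrow> D x b"
    proof (intro always_eventually allI)
      fix x
      have "((\<lambda>h. norm (w (x + h *\<^sub>R b) - w x - h *\<^sub>R D x b) / norm h) \<longlongrightarrow> 0) (at 0)"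
        using vd[of x 0] unfolding has_derivative_at by simp
      then have "((\<lambda>h. norm ((w (x + h *\<^sub>R b) - w x) /\<^sub>R h - D x b)) \<longlongrightarrow> 0) (at 0)"
      proof (rule Lim_transform_eventually)
        show "\<forall>\<^sub>F h in at 0. norm (w (x + h *\<^sub>R b) - w x - h *\<^sub>R D x b) / norm h =
            norm ((w (x + h *\<^sub>R b) - w x) /\<^sub>R h - D x b)"
        proof (intro eventually_at_filter[THEN iffD2] always_eventually allI impI)
          fix h :: real assume h: "h \<noteq> 0"
          then have "w (x + h *\<^sub>R b) - w x - h *\<^sub>R D x b = h *\<^sub>R ((w (x + h *\<^sub>R b) - w x) /\<^sub>R h - D x b)"
            by (simp add: scaleR_diff_right)
          with h show "norm (w (x + h *\<^sub>R b) - w x - h *\<^sub>R D x b) / norm h =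
              norm ((w (x + h *\<^sub>R b) - w x) /\<^sub>R h - D x b)" by simp
        qed
      qed
      then have "((\<lambda>h. (w (x + h *\<^sub>R b) - w x) /\<^sub>R h) \<longlongrightarrow> D x b) (at 0)"
        by (rule LIM_zero_cancel[OF tendsto_norm_zero_cancel])
      then have "((\<lambda>k. (w (x + inverse (real (Suc k)) *\<^sub>R b) - w x) /\<^sub>R inverse (real (Suc k))) \<longlonglongrightarrow> D x b)"
        by (rule filterlim_compose) (use LIMSEQ_inverse_real_of_nat in \<open>auto simp: filterlim_at simp del: of_nat_Suc\<close>)
      then show "(\<lambda>k. q k x) \<longlonglongrightarrow> D x b"
        by (simp add: q_def scaleR_conv_of_real)
    qed
    \<comment> \<open>The majorant must not depend on \<open>k\<close>: the mean value inequality
      along direction \<open>b\<close> bounds every quotient by \<open>B\<close>, and since the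
      steps are at most 1 all quotients vanish outside one ball, enlarged by
      \<open>norm b\<close>.\<close>
    show "AE x in lborel. norm (q k x) \<le> indicator (cball c (R + norm b)) x *\<^sub>R B" for k
    proof (intro always_eventually allI)
      fix x
      define t where "t = inverse (real (Suc k))"
      have t: "0 < t" "t \<le> 1" "real (Suc k) * t = 1" by (auto simp: t_def field_simps)
      have B0: "0 \<le> B" using order_trans[OF norm_ge_zero B] .
      have "norm (w (x + t *\<^sub>R b) - w (x + 0 *\<^sub>R b)) \<le> B * norm (t - 0)"
        by (rule differentiable_bound[where S=UNIV and f="\<lambda>s. w (x + s *\<^sub>R b)" and f'="\<lambda>s h. h *\<^sub>R D (x + s *\<^sub>R b) b"])
           (use vd B B0 in \<open>auto intro!: onorm_bound mult_left_mono simp: mult.commute[of B]\<close>)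
      then have "real (Suc k) * norm (w (x + t *\<^sub>R b) - w x) \<le> real (Suc k) * (B * t)"
        using t by (intro mult_left_mono) auto
      then have "norm (q k x) \<le> B"
        using t unfolding q_def norm_mult norm_of_nat t_def[symmetric]
        by (metis mult.left_commute mult.right_neutral)
      moreover have "q k x = 0" if "x \<notin> cball c (R + norm b)"
      proof -
        have n: "norm (x - c) > R + norm b"
          using that by (simp add: dist_norm norm_minus_commute)
        have "norm (t *\<^sub>R b) \<le> norm b"
          using t by (simp add: mult_left_le_one_le)
        moreover have "norm (x - c) \<le> norm (x + t *\<^sub>R b - c) + norm (t *\<^sub>R b)"
          using norm_triangle_ineq4[of "x + t *\<^sub>R b - c" "t *\<^sub>R b"] by (simp add: algebra_simps)
        ultimately have "norm (x + t *\<^sub>R b - c) > R"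
          using n by linarith
        moreover have "norm (x - c) > R"
          using n norm_ge_zero[of b] by linarith
        ultimately show ?thesis
          using supp by (simp add: q_def t_def)
      qed
      ultimately show "norm (q k x) \<le> indicator (cball c (R + norm b)) x *\<^sub>R B"
        by (auto simp: indicator_def)
    qed
    show "integrable lborel (\<lambda>x. indicator (cball c (R + norm b)) x *\<^sub>R B)"
      using emeasure_lborel_cball_finite[of c "R + norm b"] by (auto simp: less_top)
  qed (auto simp: q_def)
  then show ?thesis
    by (simp add: q0 LIMSEQ_const_iff)
qed

text \<open>Integration by parts without boundary terms: the exponential times \<open>u\<close> has
  compact support, so its directional derivative has integral zero, and the two terms of the product
  rule give the two sides.\<close>

lemma bumps_fourier_derivative:
  assumes u: "u \<in> bumps c"
    and D: "\<And>x. (u has_derivative D x) (at x)" "(\<lambda>x. D x b) \<in> bumps c"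
  shows "fourier (\<lambda>x. D x b) \<omega> = 2 * pi * \<i> * (\<omega> \<bullet> b) * fourier u \<omega>"
proof -
  note [measurable] = bumps_measurable[OF u] bumps_measurable[OF D(2)]
  define e where "e x = cis (- 2 * pi * (x \<bullet> \<omega>))" for x
  define E where "E x h = e x * D x h + (- 2 * pi * \<i> * (h \<bullet> \<omega>)) * e x * u x" for x h
  have [measurable]: "e \<in> borel_measurable borel"
    unfolding e_def[abs_def] by measurable
  have ne: "norm (e x) = 1" for x by (simp add: e_def)
  have "(e has_derivative (\<lambda>h. (- 2 * pi * \<i> * (h \<bullet> \<omega>)) * e x)) (at x)" for x
    unfolding e_def[abs_def] cis_conv_exp
    by (rule has_derivative_eq_rhs, rule has_derivative_compose[OF _ DERIV_exp[unfolded has_field_derivative_def]])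
       (auto intro!: derivative_eq_intros simp: algebra_simps)
  then have deriv: "((\<lambda>x. e x * u x) has_derivative E x) (at x)" for x
    unfolding E_def[abs_def] by (rule has_derivative_eq_rhs[OF has_derivative_mult[OF _ D(1)]]) auto
  obtain B where B: "\<And>x. norm (u x) \<le> B" "B \<ge> 0" using bumps_bounded[OF u] by blast
  obtain B' where B': "\<And>x. norm (D x b) \<le> B'" using bumps_bounded[OF D(2)] by blast
  have "(\<integral>x. E x b \<partial>lborel) = 0"
  proof (rule integral_derivative_compact_support[OF deriv])
    show "norm (E x b) \<le> B' + 2 * pi * \<bar>b \<bullet> \<omega>\<bar> * B" for x
      unfolding E_def using B B'
      by (intro norm_triangle_le add_mono) (auto simp: norm_mult ne intro!: mult_left_mono)
    show "norm (e x * u x) \<le> B" for x using B by (simp add: norm_mult ne)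
    show "norm (x - c) > 1 \<Longrightarrow> e x * u x = 0" for x
      using bumps_outside[OF u] by simp
  qed (simp add: E_def)
  moreover have "integrable lborel (\<lambda>x. e x * D x b)" "integrable lborel (\<lambda>x. e x * u x)"
    using bumps_integrable[OF u] bumps_integrable[OF D(2)]
    unfolding e_def by (auto intro!: integrable_cis_mult)
  ultimately have "(\<integral>x. e x * D x b \<partial>lborel) + (- 2 * pi * \<i> * (b \<bullet> \<omega>)) * (\<integral>x. e x * u x \<partial>lborel) = 0"
    unfolding E_def by (simp add: mult.assoc)
  then show ?thesis
    by (simp add: fourier_lborel e_def inner_commute add_eq_0_iff)
qed

text \<open>Each power of the norm is bounded by the sum of the coordinates and each coordinate is
  traded for a partial derivative, which lies again in \<open>bumps c\<close>; hence the induction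
  over arbitrary \<open>u\<close>. The factor 2 * pi is at least 1 and is dropped.\<close>

lemma bumps_fourier_decay:
  fixes c :: "'a::euclidean_space"
  assumes "u \<in> bumps c"
  shows "\<exists>C. \<forall>\<xi>. norm \<xi> ^ N * norm (fourier u \<xi>) \<le> C"
  using assms
proof (induction N arbitrary: u)
  case 0
  then show ?case
    using norm_fourier_le[OF bumps_integrable[OF 0]] by auto
next
  case (Suc N)
  obtain D where D: "\<And>x. (u has_derivative D x) (at x)" "\<And>b. (\<lambda>x. D x b) \<in> bumps c"
    using bumps_has_derivative[OF Suc.prems] by blast
  obtain C where C: "\<And>b \<xi>. norm \<xi> ^ N * norm (fourier (\<lambda>x. D x b) \<xi>) \<le> C b"
    using Suc.IH[OF D(2)] by metis
  have "norm \<xi> ^ Suc N * norm (fourier u \<xi>) \<le> (\<Sum>b\<in>Basis. C b)" for \<xi>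
  proof -
    have *: "\<bar>\<xi> \<bullet> b\<bar> * norm (fourier u \<xi>) \<le> norm (fourier (\<lambda>x. D x b) \<xi>)" for b
    proof -
      have "norm (fourier (\<lambda>x. D x b) \<xi>) = (2 * pi) * (\<bar>\<xi> \<bullet> b\<bar> * norm (fourier u \<xi>))"
        by (subst bumps_fourier_derivative[OF Suc.prems D]) (simp add: norm_mult)
      moreover have "1 * (\<bar>\<xi> \<bullet> b\<bar> * norm (fourier u \<xi>)) \<le> (2 * pi) * (\<bar>\<xi> \<bullet> b\<bar> * norm (fourier u \<xi>))"
        using pi_ge_two by (intro mult_right_mono) auto
      ultimately show ?thesis by simp
    qed
    have "norm \<xi> ^ Suc N * norm (fourier u \<xi>) = norm \<xi> ^ N * (norm \<xi> * norm (fourier u \<xi>))"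
      by simp
    also have "\<dots> \<le> norm \<xi> ^ N * ((\<Sum>b\<in>Basis. \<bar>\<xi> \<bullet> b\<bar>) * norm (fourier u \<xi>))"
      by (intro mult_left_mono mult_right_mono norm_le_l1) auto
    also have "\<dots> = (\<Sum>b\<in>Basis. norm \<xi> ^ N * (\<bar>\<xi> \<bullet> b\<bar> * norm (fourier u \<xi>)))"
      by (simp add: sum_distrib_left sum_distrib_right)
    also have "\<dots> \<le> (\<Sum>b\<in>Basis. C b)"
      by (intro sum_mono order_trans[OF mult_left_mono[OF *] C]) auto
    finally show ?thesis .
  qed
  then show ?case by blast
qed

section \<open>Rapid decay\<close>

text \<open>The square of \<open>japanese_bracket\<close>, free of square roots: the Sobolev weight
  of order 2n becomes \<open>weight x ^ n\<close>.\<close>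

definition weight :: "'a::euclidean_space \<Rightarrow> real" where
  "weight x = 1 + (norm x)\<^sup>2"

lemma weight_ge_1 [simp]: "1 \<le> weight x"
  by (simp add: weight_def)

lemma weight_pos [simp]: "0 < weight x"
  using weight_ge_1[of x] by linarith

lemma weight_nonneg [simp]: "0 \<le> weight x"
  using weight_pos[of x] by linarith

lemma weight_neq_0 [simp]: "weight x \<noteq> 0"
  using weight_pos[of x] by linarith

lemma weight_measurable [measurable]: "weight \<in> borel_measurable borel"
  unfolding weight_def[abs_def] by measurable

lemma weight_Pair: "weight x \<le> weight (x, y)" "weight y \<le> weight (x, y)"
  by (auto simp: weight_def norm_Pair)

text \<open>Triangle inequality for x = (x + y) - y. It is stated with a sum because the
  convolutions below have kernels evaluated at sums.\<close>

lemma weight_le_add: "weight x \<le> 2 * weight (x + y) * weight y"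
proof -
  have "norm x \<le> norm (x + y) + norm y"
    using norm_triangle_ineq4[of "x + y" y] by simp
  then have "(norm x)\<^sup>2 \<le> (norm (x + y) + norm y)\<^sup>2"
    by (intro power_mono) auto
  also have "\<dots> \<le> 2 * (norm (x + y))\<^sup>2 + 2 * (norm y)\<^sup>2"
    using zero_le_power2[of "norm (x + y) - norm y"] by (simp add: power2_diff power2_sum)
  finally have "weight x \<le> 2 * (1 + (norm (x + y))\<^sup>2 + (norm y)\<^sup>2)"
    by (simp add: weight_def)
  also have "\<dots> \<le> 2 * (weight (x + y) * weight y)"
    by (simp add: weight_def algebra_simps)
  finally show ?thesis by simp
qed

text \<open>\<open>weight x\<close> dominates 1 + (x \<bullet> b)^2 for every basis vector
  \<open>b\<close>, so its inverse to the power of the dimension lies below a tensor product of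
  integrable one-dimensional functions.\<close>

lemma integrable_inverse_weight:
  assumes "DIM('a) \<le> N"
  shows "integrable lborel (\<lambda>x::'a::euclidean_space. 1 / weight x ^ N)"
proof (rule Bochner_Integration.integrable_bound)
  have "integrable lborel (\<lambda>t::real. inverse (1 + t\<^sup>2))"
    using integrable_inverse_1_plus_square by (simp add: set_integrable_def einterval_def)
  then show "integrable lborel (\<lambda>x::'a. \<Prod>b\<in>Basis. inverse (1 + (x \<bullet> b)\<^sup>2))"
    by (rule lborel_prod_coordinates(1))
  have "1 / weight x ^ N \<le> (\<Prod>b\<in>Basis. inverse (1 + (x \<bullet> b)\<^sup>2))" for x :: 'a
  proof -
    have "1 / weight x ^ N \<le> inverse (weight x) ^ DIM('a)"
      unfolding inverse_eq_divide power_one_over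
      using assms by (intro divide_left_mono power_increasing) auto
    also have "\<dots> \<le> (\<Prod>b\<in>Basis. inverse (1 + (x \<bullet> b)\<^sup>2))"
      unfolding prod_constant[symmetric]
    proof (intro prod_mono conjI le_imp_inverse_le)
      fix b :: 'a assume "b \<in> Basis"
      then have "\<bar>x \<bullet> b\<bar>\<^sup>2 \<le> (norm x)\<^sup>2"
        by (intro power_mono Basis_le_norm) auto
      then show "1 + (x \<bullet> b)\<^sup>2 \<le> weight x" by (simp add: weight_def)
    qed (auto simp: add_pos_nonneg)
    finally show ?thesis .
  qed
  moreover have "0 \<le> (\<Prod>b\<in>Basis. inverse (1 + (x \<bullet> b)\<^sup>2))" for x :: 'a
    by (intro prod_nonneg) auto
  ultimately show "AE x in lborel. norm (1 / weight (x::'a) ^ N) \<le> norm (\<Prod>b\<in>Basis. inverse (1 + (x \<bullet> b)\<^sup>2))"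
    by (intro AE_I2) simp
qed measurable

text \<open>Only the size bounds of \<open>schwartz\<close> are kept. This class contains the test
  functions as well as the transforms of bumps and of \<open>\<phi> x * fourier \<psi> x\<close>, so
  derivatives of the latter never have to be estimated.\<close>

definition rapidly_decreasing :: "('a::euclidean_space \<Rightarrow> complex) \<Rightarrow> bool" where
  "rapidly_decreasing f \<longleftrightarrow> f \<in> borel_measurable borel \<and> (\<forall>N. \<exists>C. \<forall>x. norm (f x) \<le> C / weight x ^ N)"

lemma rapidly_decreasingI:
  assumes "f \<in> borel_measurable borel" "\<And>N. \<exists>C. \<forall>x. norm x ^ N * norm (f x) \<le> C"
  shows "rapidly_decreasing f"
  unfolding rapidly_decreasing_def
proof (intro conjI allI assms(1))
  fix N
  obtain C0 where C0: "\<And>x. norm x ^ 0 * norm (f x) \<le> C0"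
    using assms(2)[of 0] by blast
  obtain C where C: "\<And>x. norm x ^ (2 * N) * norm (f x) \<le> C"
    using assms(2)[of "2 * N"] by blast
  have "norm (f x) \<le> 2 ^ N * (C0 + C) / weight x ^ N" for x
  proof -
    have "weight x ^ N \<le> 2 ^ N * (1 + norm x ^ (2 * N))"
    proof (cases "norm x \<le> 1")
      case True
      then have "weight x ^ N \<le> 2 ^ N * 1"
        using power_mono[of "weight x" 2 N] by (simp add: weight_def power_le_one)
      also have "\<dots> \<le> 2 ^ N * (1 + norm x ^ (2 * N))"
        by (intro mult_left_mono) auto
      finally show ?thesis .
    next
      case False
      then have "weight x \<le> 2 * (norm x)\<^sup>2"
        by (simp add: weight_def one_le_power)
      then have "weight x ^ N \<le> (2 * (norm x)\<^sup>2) ^ N"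
        by (intro power_mono) auto
      also have "\<dots> = 2 ^ N * norm x ^ (2 * N)"
        by (simp add: power_mult_distrib power_mult)
      also have "\<dots> \<le> 2 ^ N * (1 + norm x ^ (2 * N))"
        by (intro mult_left_mono) auto
      finally show ?thesis .
    qed
    then have "weight x ^ N * norm (f x) \<le> 2 ^ N * (1 + norm x ^ (2 * N)) * norm (f x)"
      by (intro mult_right_mono) auto
    also have "\<dots> = 2 ^ N * (norm x ^ 0 * norm (f x) + norm x ^ (2 * N) * norm (f x))"
      by (simp add: algebra_simps)
    also have "\<dots> \<le> 2 ^ N * (C0 + C)"
      by (intro mult_left_mono add_mono C0 C) auto
    finally show ?thesis by (simp add: field_simps)
  qed
  then show "\<exists>C. \<forall>x. norm (f x) \<le> C / weight x ^ N" by blast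
qed

lemma rapidly_decreasingE:
  fixes f :: "'a::euclidean_space \<Rightarrow> complex"
  assumes "rapidly_decreasing f"
  obtains C where "0 \<le> C" "\<And>x. norm (f x) \<le> C / weight x ^ N"
proof -
  obtain C where C: "\<And>x. norm (f x) \<le> C / weight x ^ N"
    using assms by (auto simp: rapidly_decreasing_def)
  have "0 \<le> C / weight (0::'a) ^ N"
    using order_trans[OF norm_ge_zero C[of 0]] .
  then have "0 \<le> C" by (simp add: weight_def)
  then show thesis using C that by blast
qed

lemma rapidly_decreasing_measurable: "rapidly_decreasing f \<Longrightarrow> f \<in> borel_measurable borel"
  by (simp add: rapidly_decreasing_def)

lemma rapidly_decreasing_integrable:
  fixes f :: "'a::euclidean_space \<Rightarrow> complex"
  assumes "rapidly_decreasing f"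
  shows "integrable lborel (\<lambda>x. weight x ^ k *\<^sub>R f x)"
proof -
  note [measurable] = rapidly_decreasing_measurable[OF assms]
  obtain C where C: "0 \<le> C" "\<And>x. norm (f x) \<le> C / weight x ^ (k + DIM('a))"
    using rapidly_decreasingE[OF assms] by blast
  show ?thesis
  proof (rule Bochner_Integration.integrable_bound)
    show "integrable lborel (\<lambda>x::'a. C * (1 / weight x ^ DIM('a)))"
      by (intro integrable_mult_right integrable_inverse_weight) simp
    have "norm (weight x ^ k *\<^sub>R f x) \<le> C * (1 / weight x ^ DIM('a))" for x
      using mult_left_mono[OF C(2), of "weight x ^ k" x] by (simp add: power_add)
    then show "AE x in lborel. norm (weight x ^ k *\<^sub>R f x) \<le> norm (C * (1 / weight x ^ DIM('a)))"
      using C(1) by (intro AE_I2) simp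
  qed measurable
qed

lemma schwartz_rapidly_decreasing:
  assumes "schwartz f"
  shows "rapidly_decreasing f"
proof (rule rapidly_decreasingI)
  have "f differentiable (at x)" for x
    using assms unfolding schwartz_def smooth_def by (metis iter_deriv.simps(1) empty_subsetI list.set(1))
  then have "isCont f x" for x
    using differentiable_imp_continuous_within by blast
  then show "f \<in> borel_measurable borel"
    by (intro borel_measurable_continuous_onI continuous_at_imp_continuous_on) auto
  show "\<exists>C. \<forall>x. norm x ^ N * norm (f x) \<le> C" for N
  proof -
    have "bounded (range (\<lambda>x. norm x ^ N *\<^sub>R iter_deriv [] f x))"
      using assms unfolding schwartz_def by (metis empty_subsetI list.set(1))
    then show ?thesis
      unfolding bounded_iff by auto
  qed
qed

lemma bumps_fourier_rapidly_decreasing: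
  assumes "u \<in> bumps c"
  shows "rapidly_decreasing (fourier u)"
  by (rule rapidly_decreasingI) (use bumps_fourier_decay[OF assms] bumps_measurable[OF assms] in auto)

text \<open>By Peetre's inequality \<open>weight_le_add\<close> the convolution decays as fast as its factors.\<close>

lemma fourier_bump_mult_fourier:
  fixes c :: "'a::euclidean_space"
  assumes \<phi>: "\<phi> \<in> bumps c" and \<psi>: "rapidly_decreasing \<psi>"
  shows "fourier (\<lambda>x. \<phi> x * fourier \<psi> x) \<xi> = (\<integral>y. fourier \<phi> (\<xi> + y) * \<psi> y \<partial>lborel)"
    and "rapidly_decreasing (fourier (\<lambda>x. \<phi> x * fourier \<psi> x))"
    and "integrable lborel (\<lambda>x. \<phi> x * fourier \<psi> x)"
proof -
  note [measurable] = bumps_measurable[OF \<phi>] rapidly_decreasing_measurable[OF \<psi>]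
  have \<psi>i: "integrable lborel \<psi>"
    using rapidly_decreasing_integrable[OF \<psi>, of 0] by simp
  show "integrable lborel (\<lambda>x. \<phi> x * fourier \<psi> x)"
  proof (rule Bochner_Integration.integrable_bound)
    show "integrable lborel (\<lambda>x. (\<integral>x. norm (\<psi> x) \<partial>lborel) *\<^sub>R \<phi> x)"
      using bumps_integrable[OF \<phi>] by simp
    have "norm (\<phi> x * fourier \<psi> x) \<le> norm ((\<integral>x. norm (\<psi> x) \<partial>lborel) *\<^sub>R \<phi> x)" for x
      using mult_left_mono[OF norm_fourier_le[OF \<psi>i, of x], of "norm (\<phi> x)"]
      by (simp add: norm_mult mult.commute)
    then show "AE x in lborel. norm (\<phi> x * fourier \<psi> x) \<le> norm ((\<integral>x. norm (\<psi> x) \<partial>lborel) *\<^sub>R \<phi> x)"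
      by (intro AE_I2)
  qed measurable
  have eq: "fourier (\<lambda>x. \<phi> x * fourier \<psi> x) \<xi> = (\<integral>y. fourier \<phi> (\<xi> + y) * \<psi> y \<partial>lborel)" for \<xi>
  proof -
    define v where "v x = cis (- 2 * pi * (x \<bullet> \<xi>)) * \<phi> x" for x
    have v: "integrable lborel v"
      unfolding v_def[abs_def] using bumps_integrable[OF \<phi>] by (rule integrable_cis_mult) simp
    have [measurable]: "v \<in> borel_measurable borel" using v by auto
    \<comment> \<open>Modulation shifts the transform. The result has \<xi> + y rather than \<xi> -
      y because the forward transform is applied to \<psi> twice, which is a reflection.\<close>
    have V: "fourier v y = fourier \<phi> (\<xi> + y)" for y
    proof -
      have "cis (- 2 * pi * (x \<bullet> y)) * v x = cis (- 2 * pi * (x \<bullet> (\<xi> + y))) * \<phi> x" for x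
        unfolding v_def mult.assoc[symmetric] cis_mult by (simp add: inner_add_right algebra_simps)
      then show ?thesis by (simp add: fourier_lborel)
    qed
    have "fourier (\<lambda>x. \<phi> x * fourier \<psi> x) \<xi> = (\<integral>x. fourier \<psi> x * v x \<partial>lborel)"
      by (subst fourier_lborel) (auto simp: v_def mult_ac)
    also have "\<dots> = (\<integral>y. \<psi> y * fourier v y \<partial>lborel)"
      by (rule fourier_multiplication[OF \<psi>i v])
    finally show ?thesis by (simp add: V mult.commute)
  qed
  then show "fourier (\<lambda>x. \<phi> x * fourier \<psi> x) \<xi> = (\<integral>y. fourier \<phi> (\<xi> + y) * \<psi> y \<partial>lborel)" .
  show "rapidly_decreasing (fourier (\<lambda>x. \<phi> x * fourier \<psi> x))"
    unfolding rapidly_decreasing_def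
  proof (intro conjI allI)
    fix N
    obtain C where C: "0 \<le> C" "\<And>x. norm (fourier \<phi> x) \<le> C / weight x ^ N"
      using rapidly_decreasingE[OF bumps_fourier_rapidly_decreasing[OF \<phi>]] by blast
    define K where "K = C * 2 ^ N * (\<integral>y. norm (weight y ^ N *\<^sub>R \<psi> y) \<partial>lborel)"
    have "norm (fourier (\<lambda>x. \<phi> x * fourier \<psi> x) \<xi>) \<le> K / weight \<xi> ^ N" for \<xi>
    proof -
      have i: "integrable lborel (\<lambda>y. (C * 2 ^ N / weight \<xi> ^ N) * norm (weight y ^ N *\<^sub>R \<psi> y))"
        by (intro integrable_mult_right integrable_norm rapidly_decreasing_integrable[OF \<psi>])
      have le: "norm (fourier \<phi> (\<xi> + y) * \<psi> y) \<le> (C * 2 ^ N / weight \<xi> ^ N) * norm (weight y ^ N *\<^sub>R \<psi> y)" for y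
      proof -
        have "weight \<xi> ^ N \<le> 2 ^ N * weight (\<xi> + y) ^ N * weight y ^ N"
          unfolding power_mult_distrib[symmetric] by (intro power_mono weight_le_add) simp
        then have "1 / weight (\<xi> + y) ^ N \<le> 2 ^ N * weight y ^ N / weight \<xi> ^ N"
          by (simp add: field_simps)
        then have "C / weight (\<xi> + y) ^ N \<le> C * (2 ^ N * weight y ^ N / weight \<xi> ^ N)"
          using mult_left_mono[of _ _ C] C(1) by fastforce
        then have "norm (fourier \<phi> (\<xi> + y)) \<le> C * (2 ^ N * weight y ^ N / weight \<xi> ^ N)"
          using C(2)[of "\<xi> + y"] by linarith
        then have "norm (fourier \<phi> (\<xi> + y)) * norm (\<psi> y) \<le> C * (2 ^ N * weight y ^ N / weight \<xi> ^ N) * norm (\<psi> y)"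
          by (rule mult_right_mono) simp
        then show ?thesis by (simp add: norm_mult field_simps)
      qed
      have "norm (\<integral>y. fourier \<phi> (\<xi> + y) * \<psi> y \<partial>lborel) \<le> (\<integral>y. (C * 2 ^ N / weight \<xi> ^ N) * norm (weight y ^ N *\<^sub>R \<psi> y) \<partial>lborel)"
      proof (rule Bochner_Integration.integral_norm_bound_integral[OF _ i le])
        show "integrable lborel (\<lambda>y. fourier \<phi> (\<xi> + y) * \<psi> y)"
        proof (rule Bochner_Integration.integrable_bound[OF i])
          show "AE y in lborel. norm (fourier \<phi> (\<xi> + y) * \<psi> y) \<le>
              norm ((C * 2 ^ N / weight \<xi> ^ N) * norm (weight y ^ N *\<^sub>R \<psi> y))"
            using le by (intro AE_I2) (metis abs_ge_self order_trans real_norm_def)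
        qed measurable
      qed
      then show ?thesis by (simp add: eq K_def)
    qed
    then show "\<exists>C. \<forall>\<xi>. norm (fourier (\<lambda>x. \<phi> x * fourier \<psi> x) \<xi>) \<le> C / weight \<xi> ^ N" by blast
  qed measurable
qed

section \<open>The Wigner distribution and the ambiguity function\<close>

definition wigner_kernel :: "('a::euclidean_space \<Rightarrow> complex) \<Rightarrow> 'a \<Rightarrow> 'a \<Rightarrow> complex" where
  "wigner_kernel f p y = f (p + y /\<^sub>R 2) * cnj (f (p - y /\<^sub>R 2))"

text \<open>The partial transform of the kernel in \<open>p\<close>, where \<open>wigner\<close> is
  the one in \<open>y\<close>. Signs and order of the arguments are those of the symplectic Fourier
  transform of the Wigner distribution.\<close>

fun ambiguity :: "('a::euclidean_space \<Rightarrow> complex) \<Rightarrow> 'a \<times> 'a \<Rightarrow> complex" where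
  "ambiguity f (z1, z2) = fourier (\<lambda>p. wigner_kernel f p z1) z2"

lemma wigner_eq_fourier: "wigner f (x, \<omega>) = fourier (wigner_kernel f x) \<omega>"
  by (simp add: fourier_def wigner_kernel_def mult_ac)

text \<open>For each fixed point the two factors are affine substitutions of \<open>f\<close> with
  slope 1/2 or -1/2, and these pull null sets back to null sets. The Wigner functions hence agree
  everywhere, and \<open>f\<close> may be replaced by a Borel function.\<close>

lemma wigner_cong_AE:
  fixes f g :: "'a::euclidean_space \<Rightarrow> complex"
  assumes f: "f \<in> borel_measurable lebesgue" and g: "g \<in> borel_measurable borel"
    and eq: "AE x in lborel. f x = g x"
  shows "wigner f = wigner g"
proof -
  have affine: "AE y in lebesgue. f (x + c *\<^sub>R y) = g (x + c *\<^sub>R y)" if c: "c \<noteq> 0" for x c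
  proof -
    from eq obtain N where "{x \<in> space lborel. f x \<noteq> g x} \<subseteq> N" "emeasure lborel N = 0" "N \<in> sets lborel"
      by (rule AE_E)
    then have N: "N \<in> null_sets lborel" "\<And>x. x \<notin> N \<Longrightarrow> f x = g x"
      by auto
    have [measurable]: "N \<in> sets borel" using N(1) by auto
    have "0 = ennreal (\<bar>c\<bar> ^ DIM('a)) * (\<integral>\<^sup>+y. indicator N (x + c *\<^sub>R y) \<partial>lborel)"
      using N(1) nn_integral_lborel_affine[of "indicator N" c x] c by (auto simp: null_sets_def)
    then have "(\<integral>\<^sup>+y. indicator N (x + c *\<^sub>R y) \<partial>lborel) = 0"
      using c by simp
    then have "AE y in lborel. indicator N (x + c *\<^sub>R y) = (0 :: ennreal)"
      by (subst (asm) nn_integral_0_iff_AE) auto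
    then have "AE y in lborel. f (x + c *\<^sub>R y) = g (x + c *\<^sub>R y)"
      by (rule eventually_mono) (use N(2) in \<open>auto simp: indicator_def split: if_splits\<close>)
    then show ?thesis by (rule AE_completion)
  qed
  have "wigner f (x, \<omega>) = wigner g (x, \<omega>)" for x \<omega>
  proof -
    have [measurable]: "g \<in> borel_measurable borel" by (rule g)
    let ?G = "\<lambda>y. g (x + y /\<^sub>R 2) * cnj (g (x - y /\<^sub>R 2)) * cis (- 2 * pi * (y \<bullet> \<omega>))"
    let ?F = "\<lambda>y. f (x + y /\<^sub>R 2) * cnj (f (x - y /\<^sub>R 2)) * cis (- 2 * pi * (y \<bullet> \<omega>))"
    have "AE y in lebesgue. f (x + (1/2) *\<^sub>R y) = g (x + (1/2) *\<^sub>R y)"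
      "AE y in lebesgue. f (x + (-1/2) *\<^sub>R y) = g (x + (-1/2) *\<^sub>R y)"
      by (rule affine, simp)+
    then have ae: "AE y in lebesgue. ?G y = ?F y"
      by eventually_elim simp
    have G: "?G \<in> borel_measurable lebesgue"
      by (rule measurable_completion) measurable
    \<comment> \<open>Measurability of the integrand built from the Lebesgue measurable
      \<open>f\<close> is inherited from its Borel counterpart, as the measure is complete.\<close>
    have F: "?F \<in> borel_measurable lebesgue"
      by (rule borel_measurable_AE[OF G ae])
    show ?thesis
      using integral_cong_AE[OF G F ae] by simp
  qed
  then show ?thesis by auto
qed

lemma square_integrable_borel_representative:
  fixes f :: "'a::euclidean_space \<Rightarrow> complex"
  assumes "square_integrable f"
  obtains g where "g \<in> borel_measurable borel" "integrable lborel (\<lambda>x. (norm (g x))\<^sup>2)" "wigner g = wigner f"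
proof -
  have f: "f \<in> borel_measurable lebesgue" and i: "integrable lebesgue (\<lambda>x. (norm (f x))\<^sup>2)"
    using assms by (auto simp: square_integrable_def)
  have "(\<lambda>x. Re (f x)) \<in> borel_measurable lebesgue" "(\<lambda>x. Im (f x)) \<in> borel_measurable lebesgue"
    using f by measurable
  from this[THEN completion_ex_borel_measurable_real]
  obtain r s where r: "r \<in> borel_measurable lborel" "AE x in lborel. Re (f x) = r x"
    and s: "s \<in> borel_measurable lborel" "AE x in lborel. Im (f x) = s x"
    by blast
  define g where "g x = Complex (r x) (s x)" for x
  have g[measurable]: "g \<in> borel_measurable borel"
    using r(1) s(1) unfolding g_def[abs_def] Complex_eq by measurable
  have eq: "AE x in lborel. f x = g x"
    using r(2) s(2) by eventually_elim (simp add: g_def complex_eq_iff)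
  have "integrable lebesgue (\<lambda>x. (norm (g x))\<^sup>2)"
  proof (rule integrable_cong_AE_imp[OF i])
    show "(\<lambda>x. (norm (g x))\<^sup>2) \<in> borel_measurable lebesgue"
      by (rule measurable_completion) measurable
    show "AE x in lebesgue. (norm (f x))\<^sup>2 = (norm (g x))\<^sup>2"
      by (rule AE_completion) (use eq in eventually_elim, simp)
  qed
  then have "integrable lborel (\<lambda>x. (norm (g x))\<^sup>2)"
    by (subst (asm) integrable_completion) auto
  then show thesis
    using that[OF g] wigner_cong_AE[OF f g eq] by simp
qed

lemma norm_mult_le_squares: "norm (a * b) \<le> (norm a)\<^sup>2 / 2 + (norm (b :: complex))\<^sup>2 / 2"
  using zero_le_power2[of "norm a - norm b"] by (simp add: norm_mult power2_diff)

context
  fixes f :: "'a::euclidean_space \<Rightarrow> complex"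
  assumes f[measurable]: "f \<in> borel_measurable borel"
    and f2: "integrable lborel (\<lambda>x. (norm (f x))\<^sup>2)"
begin

lemma wigner_kernel_measurable [measurable]:
  "(\<lambda>(p, y). wigner_kernel f p y) \<in> borel_measurable (borel \<Otimes>\<^sub>M borel)"
  unfolding wigner_kernel_def by measurable

lemma wigner_kernel_integrable_snd: "integrable lborel (wigner_kernel f p)"
proof (rule Bochner_Integration.integrable_bound)
  have "integrable lborel (\<lambda>y. (norm (f (p + c *\<^sub>R y)))\<^sup>2 / 2)" if "c \<noteq> 0" for c
    using integrable_lborel_affine[OF f2 that] by (rule integrable_divide)
  from this[of "1/2"] this[of "-1/2"]
  show "integrable lborel (\<lambda>y. (norm (f (p + (1/2) *\<^sub>R y)))\<^sup>2 / 2 + (norm (f (p + (-1/2) *\<^sub>R y)))\<^sup>2 / 2)"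
    by (intro Bochner_Integration.integrable_add) auto
  have "norm (wigner_kernel f p y) \<le> (norm (f (p + (1/2) *\<^sub>R y)))\<^sup>2 / 2 + (norm (f (p + (-1/2) *\<^sub>R y)))\<^sup>2 / 2" for y
    using norm_mult_le_squares[of "f (p + y /\<^sub>R 2)" "cnj (f (p - y /\<^sub>R 2))"]
    by (simp add: wigner_kernel_def)
  then show "AE y in lborel. norm (wigner_kernel f p y) \<le>
      norm ((norm (f (p + (1/2) *\<^sub>R y)))\<^sup>2 / 2 + (norm (f (p + (-1/2) *\<^sub>R y)))\<^sup>2 / 2)"
    by (intro AE_I2) (metis abs_ge_self order_trans real_norm_def)
qed measurable

text \<open>By ab \<le> a^2 / 2 + b^2 / 2 the kernel is dominated by two translates of half the
  squared modulus of \<open>f\<close>. The resulting bound does not depend on \<open>y\<close>,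
  which makes the ambiguity function bounded.\<close>

lemma wigner_kernel_fst:
  shows "integrable lborel (\<lambda>p. wigner_kernel f p y)"
    and "(\<integral>p. norm (wigner_kernel f p y) \<partial>lborel) \<le> (\<integral>x. (norm (f x))\<^sup>2 \<partial>lborel)"
proof -
  have i: "integrable lborel (\<lambda>p. (norm (f (p + a)))\<^sup>2 / 2)" for a
    using integrable_lborel_shift[OF f2, of a] by (rule integrable_divide)
  have shift: "(\<integral>p. (norm (f (p + a)))\<^sup>2 / 2 \<partial>lborel) = (\<integral>x. (norm (f x))\<^sup>2 \<partial>lborel) / 2" for a
    using integral_lborel_shift[of "\<lambda>x. (norm (f x))\<^sup>2" a] by simp
  define R where "R p = (norm (f (p + y /\<^sub>R 2)))\<^sup>2 / 2 + (norm (f (p + - (y /\<^sub>R 2))))\<^sup>2 / 2" for p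
  have R: "integrable lborel R"
    unfolding R_def[abs_def] by (intro Bochner_Integration.integrable_add i)
  have le: "norm (wigner_kernel f p y) \<le> R p" for p
    using norm_mult_le_squares[of "f (p + y /\<^sub>R 2)" "cnj (f (p - y /\<^sub>R 2))"]
    by (simp add: wigner_kernel_def R_def)
  show int: "integrable lborel (\<lambda>p. wigner_kernel f p y)"
  proof (rule Bochner_Integration.integrable_bound[OF R])
    show "AE p in lborel. norm (wigner_kernel f p y) \<le> norm (R p)"
      using le by (intro AE_I2) (metis abs_ge_self order_trans real_norm_def)
  qed measurable
  have "(\<integral>p. norm (wigner_kernel f p y) \<partial>lborel) \<le> (\<integral>p. R p \<partial>lborel)"
    by (intro integral_mono integrable_norm int R le)
  also have "\<dots> = (\<integral>x. (norm (f x))\<^sup>2 \<partial>lborel)"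
    unfolding R_def using i by (subst Bochner_Integration.integral_add) (simp_all only: shift field_sum_of_halves)
  finally show "(\<integral>p. norm (wigner_kernel f p y) \<partial>lborel) \<le> (\<integral>x. (norm (f x))\<^sup>2 \<partial>lborel)" .
qed

text \<open>The map from (p, y) to (p + y/2, p - y/2) preserves volume, so the integral factors into
  the square of the integral of |f|^2. It is carried out as a shift in \<open>p\<close> for fixed
  \<open>y\<close>, followed by a shift in \<open>y\<close> for fixed \<open>p\<close>.\<close>

lemma wigner_kernel_L2:
  "(\<integral>\<^sup>+y. \<integral>\<^sup>+p. ennreal ((norm (wigner_kernel f p y))\<^sup>2) \<partial>lborel \<partial>lborel) < \<infinity>"
proof -
  define g where "g x = ennreal ((norm (f x))\<^sup>2)" for x
  have [measurable]: "g \<in> borel_measurable borel" unfolding g_def[abs_def] by measurable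
  have "(\<integral>\<^sup>+y. \<integral>\<^sup>+p. ennreal ((norm (wigner_kernel f p y))\<^sup>2) \<partial>lborel \<partial>lborel) =
    (\<integral>\<^sup>+y. \<integral>\<^sup>+p. g (p + y /\<^sub>R 2) * g (p - y /\<^sub>R 2) \<partial>lborel \<partial>lborel)"
    by (simp add: wigner_kernel_def g_def norm_mult power_mult_distrib ennreal_mult)
  also have "\<dots> = (\<integral>\<^sup>+y. \<integral>\<^sup>+p. g (p + y) * g p \<partial>lborel \<partial>lborel)"
  proof (rule nn_integral_cong)
    fix y
    have "(\<integral>\<^sup>+p. g (p + y) * g p \<partial>lborel) =
      (\<integral>\<^sup>+p. g ((p + - (y /\<^sub>R 2)) + y) * g (p + - (y /\<^sub>R 2)) \<partial>lborel)"
      by (rule nn_integral_lborel_shift[symmetric]) measurable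
    moreover have "(p + - (y /\<^sub>R 2)) + y = p + y /\<^sub>R 2" for p
    proof -
      define h where "h = y /\<^sub>R 2"
      have "y = h + h"
        by (simp add: h_def flip: scaleR_left_distrib)
      then show ?thesis
        unfolding h_def[symmetric] by simp
    qed
    ultimately have "(\<integral>\<^sup>+p. g (p + y) * g p \<partial>lborel) = (\<integral>\<^sup>+p. g (p + y /\<^sub>R 2) * g (p + - (y /\<^sub>R 2)) \<partial>lborel)"
      by (simp only:)
    then show "(\<integral>\<^sup>+p. g (p + y /\<^sub>R 2) * g (p - y /\<^sub>R 2) \<partial>lborel) = (\<integral>\<^sup>+p. g (p + y) * g p \<partial>lborel)"
      by simp
  qed
  also have "\<dots> = (\<integral>\<^sup>+p. \<integral>\<^sup>+y. g (p + y) * g p \<partial>lborel \<partial>lborel)"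
    by (rule lborel_pair.Fubini'[symmetric]) measurable
  also have "\<dots> = (\<integral>\<^sup>+p. (\<integral>\<^sup>+y. g (y + p) \<partial>lborel) * g p \<partial>lborel)"
    by (intro nn_integral_cong, subst nn_integral_multc) (simp_all add: add.commute)
  also have "\<dots> = (\<integral>\<^sup>+p. (\<integral>\<^sup>+y. g y \<partial>lborel) * g p \<partial>lborel)"
    by (subst nn_integral_lborel_shift) simp_all
  also have "\<dots> = (\<integral>\<^sup>+y. g y \<partial>lborel) * (\<integral>\<^sup>+y. g y \<partial>lborel)"
    by (simp add: nn_integral_cmult)
  also have "\<dots> < \<infinity>"
    using f2 unfolding integrable_iff_bounded g_def by (auto simp: ennreal_mult_less_top)
  finally show ?thesis .
qed

lemma wigner_measurable [measurable]: "wigner f \<in> borel_measurable borel"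
proof -
  have "wigner f = (\<lambda>(x, \<omega>). \<integral>y. cis (- 2 * pi * (y \<bullet> \<omega>)) * wigner_kernel f x y \<partial>lborel)"
    by (auto simp: wigner_eq_fourier fourier_lborel simp del: wigner.simps)
  also have "\<dots> \<in> borel_measurable (borel \<Otimes>\<^sub>M borel)"
    by measurable
  finally show ?thesis by (simp add: borel_prod)
qed

lemma ambiguity_measurable [measurable]: "ambiguity f \<in> borel_measurable borel"
proof -
  have "ambiguity f = (\<lambda>(z1, z2). \<integral>p. cis (- 2 * pi * (p \<bullet> z2)) * wigner_kernel f p z1 \<partial>lborel)"
    by (auto simp: fourier_lborel)
  also have "\<dots> \<in> borel_measurable (borel \<Otimes>\<^sub>M borel)"
    by measurable
  finally show ?thesis by (simp add: borel_prod)
qed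

text \<open>The Plancherel inequality on every fibre with fixed \<open>p\<close>. The bound for the
  ambiguity function uses the fibres with fixed \<open>y\<close> instead; both reduce to the norm of
  the same kernel.\<close>

lemma wigner_L2: "(\<integral>\<^sup>+x. ennreal ((norm (wigner f x))\<^sup>2) \<partial>lborel) < \<infinity>"
proof -
  have "(\<integral>\<^sup>+x. ennreal ((norm (wigner f x))\<^sup>2) \<partial>lborel) =
    (\<integral>\<^sup>+x1. \<integral>\<^sup>+x2. ennreal ((norm (wigner f (x1, x2)))\<^sup>2) \<partial>lborel \<partial>lborel)"
    unfolding lborel_prod[symmetric]
    by (rule lborel.nn_integral_fst[symmetric]) (simp add: lborel_prod)
  also have "\<dots> \<le> (\<integral>\<^sup>+p. \<integral>\<^sup>+y. ennreal ((norm (wigner_kernel f p y))\<^sup>2) \<partial>lborel \<partial>lborel)"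
    unfolding wigner_eq_fourier
    by (intro nn_integral_mono fourier_L2_bound wigner_kernel_integrable_snd)
  also have "\<dots> = (\<integral>\<^sup>+y. \<integral>\<^sup>+p. ennreal ((norm (wigner_kernel f p y))\<^sup>2) \<partial>lborel \<partial>lborel)"
    by (rule lborel_pair.Fubini') simp
  also note wigner_kernel_L2
  finally show ?thesis .
qed

lemma ambiguity_L2: "(\<integral>\<^sup>+z. ennreal ((norm (ambiguity f z))\<^sup>2) \<partial>lborel) < \<infinity>"
proof -
  have "(\<integral>\<^sup>+z. ennreal ((norm (ambiguity f z))\<^sup>2) \<partial>lborel) =
    (\<integral>\<^sup>+z1. \<integral>\<^sup>+z2. ennreal ((norm (ambiguity f (z1, z2)))\<^sup>2) \<partial>lborel \<partial>lborel)"
    unfolding lborel_prod[symmetric]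
    by (rule lborel.nn_integral_fst[symmetric]) (simp add: lborel_prod)
  also have "\<dots> \<le> (\<integral>\<^sup>+y. \<integral>\<^sup>+p. ennreal ((norm (wigner_kernel f p y))\<^sup>2) \<partial>lborel \<partial>lborel)"
    unfolding ambiguity.simps
    by (intro nn_integral_mono fourier_L2_bound wigner_kernel_fst)
  also note wigner_kernel_L2
  finally show ?thesis .
qed

lemma norm_ambiguity_le: "norm (ambiguity f z) \<le> (\<integral>x. (norm (f x))\<^sup>2 \<partial>lborel)"
  using order_trans[OF norm_fourier_le[OF wigner_kernel_fst(1)] wigner_kernel_fst(2)]
  by (cases z) simp

end

section \<open>The symplectic rotation and the pairing of the Wigner distribution\<close>

lemma integral_lborel_pair:
  fixes h :: "'a::euclidean_space \<times> 'b::euclidean_space \<Rightarrow> 'c::{banach, second_countable_topology}"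
  assumes "integrable lborel h"
  shows "(\<integral>z. h z \<partial>lborel) = (\<integral>x. \<integral>y. h (x, y) \<partial>lborel \<partial>lborel)"
  using lborel_pair.integral_fst'[of h] assms by (simp add: lborel_prod)

lemma AE_integrable_lborel_pair:
  fixes h :: "'a::euclidean_space \<times> 'b::euclidean_space \<Rightarrow> 'c::{banach, second_countable_topology}"
  assumes "integrable lborel h"
  shows "AE x in lborel. integrable lborel (\<lambda>y. h (x, y))"
  using lborel_pair.AE_integrable_fst'[of h] assms by (simp add: lborel_prod)

lemma nn_integral_lborel_pair:
  fixes h :: "'a::euclidean_space \<times> 'b::euclidean_space \<Rightarrow> ennreal"
  assumes "h \<in> borel_measurable borel"
  shows "(\<integral>\<^sup>+z. h z \<partial>lborel) = (\<integral>\<^sup>+x. \<integral>\<^sup>+y. h (x, y) \<partial>lborel \<partial>lborel)"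
  using lborel.nn_integral_fst[of h lborel] assms by (simp add: lborel_prod)

text \<open>The matrix of the symplectic form: it makes \<open>symp\<close> an inner product, so
  symplectic transforms become ordinary ones evaluated at rotated points.\<close>

definition rot :: "'a::euclidean_space \<times> 'a \<Rightarrow> 'a \<times> 'a" where
  "rot z = (- snd z, fst z)"

lemma rot_measurable [measurable]: "rot \<in> borel_measurable borel"
  unfolding rot_def[abs_def] by (intro borel_measurable_continuous_onI continuous_intros)

lemma isCont_rot: "isCont rot z"
  unfolding rot_def[abs_def] by (intro continuous_intros)

lemma inner_rot_antisym: "x \<bullet> rot z = - (z \<bullet> rot x)"
  by (simp add: rot_def inner_prod_def inner_commute)

lemma symp_rot: "symp z x = z \<bullet> rot x"
  by (cases z; cases x) (simp add: rot_def inner_Pair)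

lemma weight_rot [simp]: "weight (rot z) = weight z"
  by (simp add: weight_def rot_def norm_Pair norm_prod_def add.commute)

lemma nn_integral_rot:
  fixes g :: "'a::euclidean_space \<times> 'a \<Rightarrow> ennreal"
  assumes [measurable]: "g \<in> borel_measurable borel"
  shows "(\<integral>\<^sup>+z. g (rot z) \<partial>lborel) = (\<integral>\<^sup>+z. g z \<partial>lborel)"
proof -
  have g[measurable]: "g \<in> borel_measurable (borel \<Otimes>\<^sub>M borel)"
    by (simp add: borel_prod)
  have "(\<integral>\<^sup>+z. g (rot z) \<partial>lborel) = (\<integral>\<^sup>+x. \<integral>\<^sup>+y. g (0 - y, x) \<partial>lborel \<partial>lborel)"
    by (subst nn_integral_lborel_pair) (measurable, simp add: rot_def)
  also have "\<dots> = (\<integral>\<^sup>+x. \<integral>\<^sup>+y. g (y, x) \<partial>lborel \<partial>lborel)"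
    by (rule nn_integral_cong, rule nn_integral_lborel_reflect) measurable
  also have "\<dots> = (\<integral>\<^sup>+y. \<integral>\<^sup>+x. g (y, x) \<partial>lborel \<partial>lborel)"
    by (rule lborel_pair.Fubini') simp
  also have "\<dots> = (\<integral>\<^sup>+z. g z \<partial>lborel)"
    by (rule nn_integral_lborel_pair[symmetric]) simp
  finally show ?thesis .
qed

text \<open>The weak form of: the symplectic Fourier transform of the Wigner distribution is the
  ambiguity function. Fubini cannot be applied directly, the Wigner distribution being only square
  integrable. For fixed x1 the second factor is, in x2, the reflected transform of the partial
  transform \<open>H x1\<close> of \<open>Z\<close>; Parseval in x2 trades the Wigner distribution
  for its kernel, and the remaining integrand is absolutely integrable.\<close>

lemma wigner_pairing:
  fixes f :: "'a::euclidean_space \<Rightarrow> complex"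
  assumes f[measurable]: "f \<in> borel_measurable borel"
    and f2: "integrable lborel (\<lambda>x. (norm (f x))\<^sup>2)"
    and Zc: "\<And>z. isCont Z z"
    and Zb: "\<And>z. norm (Z z) \<le> C / weight z ^ (2 * DIM('a))"
  shows "(\<integral>x. wigner f x * fourier Z (rot x) \<partial>lborel) = (\<integral>z. ambiguity f z * Z z \<partial>lborel)"
proof -
  note [measurable] = wigner_measurable[OF f f2] ambiguity_measurable[OF f f2]
  have Zm[measurable]: "Z \<in> borel_measurable borel"
    by (intro borel_measurable_continuous_onI continuous_at_imp_continuous_on ballI Zc)
  then have Zm'[measurable]: "Z \<in> borel_measurable (borel \<Otimes>\<^sub>M borel)"
    by (simp add: borel_prod)
  have C: "0 \<le> C"
    using order_trans[OF norm_ge_zero Zb[of 0]] by (simp add: weight_def)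
  have Zi: "integrable lborel Z"
  proof (rule Bochner_Integration.integrable_bound)
    show "integrable lborel (\<lambda>z::'a \<times> 'a. C * (1 / weight z ^ (2 * DIM('a))))"
      by (intro integrable_mult_right integrable_inverse_weight) simp
  qed (use Zb C in \<open>auto intro!: AE_I2\<close>)
  \<comment> \<open>A majorant of the sections of \<open>Z\<close> that is uniform in the first
    component; it gives integrable sections and a bounded, continuous \<open>H x1\<close>, as
    Parseval requires.\<close>
  define m where "m y = C / weight y ^ DIM('a)" for y :: 'a
  have mi: "integrable lborel m"
    unfolding m_def[abs_def] using integrable_mult_right[OF integrable_inverse_weight[where 'a='a and N="DIM('a)"], of C] by simp
  have Zb1: "norm (Z (z1, z2)) \<le> m z1" and Zb2: "norm (Z (z1, z2)) \<le> m z2" for z1 z2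
  proof -
    have "weight w ^ DIM('a) \<le> weight (z1, z2) ^ (2 * DIM('a))" if "weight w \<le> weight (z1, z2)" for w :: 'a
      by (rule order_trans[OF power_mono[OF that] power_increasing]) auto
    from this[OF weight_Pair(1)] this[OF weight_Pair(2)]
    have "C / weight (z1, z2) ^ (2 * DIM('a)) \<le> m z1" "C / weight (z1, z2) ^ (2 * DIM('a)) \<le> m z2"
      unfolding m_def using C by (auto intro!: divide_left_mono)
    then show "norm (Z (z1, z2)) \<le> m z1" "norm (Z (z1, z2)) \<le> m z2"
      using Zb[of "(z1, z2)"] by linarith+
  qed
  have Zsec: "integrable lborel (\<lambda>z2. Z (z1, z2))" for z1
    by (rule Bochner_Integration.integrable_bound[OF mi])
       (use Zb2 in \<open>auto intro!: AE_I2 intro: order_trans[OF _ abs_ge_self]\<close>)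
  define H where "H x1 z1 = fourier (\<lambda>z2. Z (z1, z2)) x1" for x1 z1
  have Heq: "H x1 z1 = (\<integral>z2. cis (- 2 * pi * (z2 \<bullet> x1)) * Z (z1, z2) \<partial>lborel)" for x1 z1
    unfolding H_def by (rule fourier_lborel) measurable
  have Hm[measurable]: "H x1 \<in> borel_measurable borel" for x1
    unfolding Heq[abs_def] by measurable
  have cZ: "integrable lborel (\<lambda>z. cis (- 2 * pi * (snd z \<bullet> x1)) * Z z)" for x1
    by (rule integrable_cis_mult[OF Zi]) (intro borel_measurable_continuous_onI continuous_intros)
  have Hi: "integrable lborel (H x1)" for x1
    using lborel_pair.integrable_fst'[of "\<lambda>z. cis (- 2 * pi * (snd z \<bullet> x1)) * Z z"] cZ
    by (simp add: lborel_prod Heq[abs_def])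
  have Hb: "norm (H x1 z1) \<le> (\<integral>y. m y \<partial>lborel)" for x1 z1
    unfolding H_def
    by (rule order_trans[OF norm_fourier_le[OF Zsec]]) (intro integral_mono integrable_norm Zsec mi Zb2)
  have Hc: "isCont (H x1) z1" for x1 z1
    unfolding continuous_at_sequentially comp_def
  proof (intro allI impI)
    fix X assume X: "X \<longlonglongrightarrow> z1"
    show "(\<lambda>n. H x1 (X n)) \<longlonglongrightarrow> H x1 z1"
      unfolding Heq
    proof (rule integral_dominated_convergence[where w=m])
      show "AE y in lborel. (\<lambda>n. cis (- 2 * pi * (y \<bullet> x1)) * Z (X n, y)) \<longlonglongrightarrow> cis (- 2 * pi * (y \<bullet> x1)) * Z (z1, y)"
        by (intro AE_I2 tendsto_intros isCont_tendsto_compose[OF Zc] X)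
    qed (use mi Zb2 in \<open>auto simp: norm_mult\<close>)
  qed
  have K: "fourier Z (rot (x1, x2)) = fourier (H x1) (- x2)" for x1 x2
  proof -
    have "fourier Z (rot (x1, x2)) = (\<integral>z. cis (- 2 * pi * (z \<bullet> rot (x1, x2))) * Z z \<partial>lborel)"
      by (rule fourier_lborel) simp
    also have "\<dots> = (\<integral>z1. \<integral>z2. cis (- 2 * pi * ((z1, z2) \<bullet> rot (x1, x2))) * Z (z1, z2) \<partial>lborel \<partial>lborel)"
      by (rule integral_lborel_pair) (intro integrable_cis_mult Zi borel_measurable_continuous_onI continuous_intros)
    also have "\<dots> = (\<integral>z1. cis (- 2 * pi * (z1 \<bullet> (- x2))) * H x1 z1 \<partial>lborel)"
    proof (intro Bochner_Integration.integral_cong refl)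
      fix z1
      have "cis (- 2 * pi * ((z1, z2) \<bullet> rot (x1, x2))) * Z (z1, z2) =
         cis (- 2 * pi * (z1 \<bullet> (- x2))) * (cis (- 2 * pi * (z2 \<bullet> x1)) * Z (z1, z2))" for z2
        unfolding mult.assoc[symmetric] cis_mult by (simp add: rot_def inner_Pair algebra_simps)
      then show "(\<integral>z2. cis (- 2 * pi * ((z1, z2) \<bullet> rot (x1, x2))) * Z (z1, z2) \<partial>lborel) =
         cis (- 2 * pi * (z1 \<bullet> (- x2))) * H x1 z1"
        by (simp only: Heq integral_mult_right_zero)
    qed
    also have "\<dots> = fourier (H x1) (- x2)"
      by (rule fourier_lborel[symmetric]) simp
    finally show ?thesis .
  qed
  \<comment> \<open>\<open>Z\<close> is bounded by \<open>C\<close>, so its square is at most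
    \<open>C\<close> times its modulus and integrability yields square integrability.\<close>
  have K2: "(\<integral>\<^sup>+x. ennreal ((norm (fourier Z (rot x)))\<^sup>2) \<partial>lborel) < \<infinity>"
  proof -
    have "(\<integral>\<^sup>+x. ennreal ((norm (fourier Z (rot x)))\<^sup>2) \<partial>lborel) = (\<integral>\<^sup>+x. ennreal ((norm (fourier Z x))\<^sup>2) \<partial>lborel)"
      by (rule nn_integral_rot) measurable
    also have "\<dots> \<le> (\<integral>\<^sup>+x. ennreal ((norm (Z x))\<^sup>2) \<partial>lborel)"
      by (rule fourier_L2_bound[OF Zi])
    also have "\<dots> \<le> (\<integral>\<^sup>+x. ennreal C * ennreal (norm (Z x)) \<partial>lborel)"
    proof (intro nn_integral_mono)
      fix z :: "'a \<times> 'a"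
      have "C / weight z ^ (2 * DIM('a)) \<le> C"
        using C by (simp add: divide_le_eq mult_le_cancel_left1 one_le_power)
      then have "norm (Z z) * norm (Z z) \<le> C * norm (Z z)"
        using Zb[of z] by (intro mult_right_mono) auto
      then show "ennreal ((norm (Z z))\<^sup>2) \<le> ennreal C * ennreal (norm (Z z))"
        using C by (simp add: power2_eq_square ennreal_leI flip: ennreal_mult)
    qed
    also have "\<dots> < \<infinity>"
      using Zi unfolding integrable_iff_bounded by (simp add: nn_integral_cmult ennreal_mult_less_top)
    finally show ?thesis .
  qed
  have WK: "integrable lborel (\<lambda>x. wigner f x * fourier Z (rot x))"
  proof (rule Bochner_Integration.integrable_bound)
    have "integrable lborel (\<lambda>x. (norm (wigner f x))\<^sup>2)" "integrable lborel (\<lambda>x. (norm (fourier Z (rot x)))\<^sup>2)"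
      using wigner_L2[OF f f2] K2 by (auto simp: integrable_iff_bounded)
    then show "integrable lborel (\<lambda>x. (norm (wigner f x))\<^sup>2 / 2 + (norm (fourier Z (rot x)))\<^sup>2 / 2)"
      by (intro Bochner_Integration.integrable_add) auto
    show "AE x in lborel. norm (wigner f x * fourier Z (rot x)) \<le>
       norm ((norm (wigner f x))\<^sup>2 / 2 + (norm (fourier Z (rot x)))\<^sup>2 / 2)"
      using norm_mult_le_squares by (intro AE_I2) (metis abs_ge_self order_trans real_norm_def)
  qed measurable
  \<comment> \<open>The integrand after Parseval. Integrating first over \<open>x\<close> bounds the
    kernel part by the squared norm of \<open>f\<close>, uniformly in \<open>z\<close>, and
    \<open>Z\<close> is integrable.\<close>
  define Q where "Q x z = wigner_kernel f x (fst z) * (cis (- 2 * pi * (snd z \<bullet> x)) * Z z)" for x z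
  have Qm[measurable]: "(\<lambda>(x, z). Q x z) \<in> borel_measurable (borel \<Otimes>\<^sub>M borel)"
    unfolding Q_def wigner_kernel_def borel_prod[symmetric] by measurable
  have kern: "integrable lborel (\<lambda>x. wigner_kernel f x y)" for y
    by (rule wigner_kernel_fst(1)[OF f f2])
  then have kern_measurable [measurable]: "(\<lambda>x. wigner_kernel f x y) \<in> borel_measurable borel" for y
    by (intro borel_measurable_integrable[where M=lborel, simplified])
  have Q: "integrable (lborel \<Otimes>\<^sub>M lborel) (\<lambda>(x, z). Q x z)"
  proof (rule integrableI_bounded)
    have "(\<integral>\<^sup>+x. ennreal (norm (case x of (x, z) \<Rightarrow> Q x z)) \<partial>(lborel \<Otimes>\<^sub>M lborel)) =
       (\<integral>\<^sup>+z. \<integral>\<^sup>+x. ennreal (norm (Q x z)) \<partial>lborel \<partial>lborel)"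
      by (subst lborel_pair.nn_integral_snd[symmetric]) auto
    also have "\<dots> = (\<integral>\<^sup>+z. ennreal (norm (Z z)) * (\<integral>\<^sup>+x. ennreal (norm (wigner_kernel f x (fst z))) \<partial>lborel) \<partial>lborel)"
    proof (intro nn_integral_cong)
      fix z :: "'a \<times> 'a"
      show "(\<integral>\<^sup>+x. ennreal (norm (Q x z)) \<partial>lborel) =
         ennreal (norm (Z z)) * (\<integral>\<^sup>+x. ennreal (norm (wigner_kernel f x (fst z))) \<partial>lborel)"
        by (simp add: Q_def norm_mult ennreal_mult nn_integral_cmult mult.commute)
    qed
    also have "\<dots> \<le> (\<integral>\<^sup>+z. ennreal (norm (Z z)) * ennreal (\<integral>x. (norm (f x))\<^sup>2 \<partial>lborel) \<partial>lborel)"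
    proof (intro nn_integral_mono mult_left_mono)
      fix z :: "'a \<times> 'a"
      have "(\<integral>\<^sup>+x. ennreal (norm (wigner_kernel f x (fst z))) \<partial>lborel) = ennreal (\<integral>x. norm (wigner_kernel f x (fst z)) \<partial>lborel)"
        using kern by (intro nn_integral_eq_integral) auto
      then show "(\<integral>\<^sup>+x. ennreal (norm (wigner_kernel f x (fst z))) \<partial>lborel) \<le> ennreal (\<integral>x. (norm (f x))\<^sup>2 \<partial>lborel)"
        using wigner_kernel_fst(2)[OF f f2] by (simp add: ennreal_leI)
    qed simp
    also have "\<dots> < \<infinity>"
      using Zi unfolding integrable_iff_bounded by (simp add: nn_integral_multc ennreal_mult_less_top)
    finally show "(\<integral>\<^sup>+x. ennreal (norm (case x of (x, z) \<Rightarrow> Q x z)) \<partial>(lborel \<Otimes>\<^sub>M lborel)) < \<infinity>" .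
  qed simp
  have "(\<integral>x. wigner f x * fourier Z (rot x) \<partial>lborel) =
    (\<integral>x1. \<integral>x2. wigner f (x1, x2) * fourier Z (rot (x1, x2)) \<partial>lborel \<partial>lborel)"
    by (rule integral_lborel_pair[OF WK])
  also have "\<dots> = (\<integral>x. \<integral>z. Q x z \<partial>lborel \<partial>lborel)"
  proof (rule integral_cong_AE)
    \<comment> \<open>Fubini makes the sections integrable only for almost every \<open>x\<close>,
      and Parseval needs this integrability.\<close>
    show "AE x in lborel. (\<integral>x2. wigner f (x, x2) * fourier Z (rot (x, x2)) \<partial>lborel) = (\<integral>z. Q x z \<partial>lborel)"
      using AE_integrable_lborel_pair[OF WK] lborel_pair.AE_integrable_fst[OF Q]
    proof eventually_elim
      case (elim x)
      have "(\<integral>x2. wigner f (x, x2) * fourier Z (rot (x, x2)) \<partial>lborel) = (\<integral>y. wigner_kernel f x y * H x y \<partial>lborel)"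
        using elim(1) unfolding wigner_eq_fourier K
        by (intro fourier_parseval[OF wigner_kernel_integrable_snd[OF f f2] Hi Hb Hc])
      also have "\<dots> = (\<integral>y. \<integral>z2. Q x (y, z2) \<partial>lborel \<partial>lborel)"
        by (simp add: Q_def Heq)
      also have "\<dots> = (\<integral>z. Q x z \<partial>lborel)"
        by (rule integral_lborel_pair[symmetric]) (use elim(2) in simp)
      finally show ?case .
    qed
    show "(\<lambda>x1. \<integral>x2. wigner f (x1, x2) * fourier Z (rot (x1, x2)) \<partial>lborel) \<in> borel_measurable lborel"
      using lborel_pair.integrable_fst'[of "\<lambda>x. wigner f x * fourier Z (rot x)"] WK
      by (intro borel_measurable_integrable) (simp add: lborel_prod)
    show "(\<lambda>x. \<integral>z. Q x z \<partial>lborel) \<in> borel_measurable lborel"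
      using lborel_pair.integrable_fst[OF Q] by (rule borel_measurable_integrable)
  qed
  also have "\<dots> = (\<integral>z. \<integral>x. Q x z \<partial>lborel \<partial>lborel)"
    by (rule lborel_pair.Fubini_integral[OF Q, symmetric])
  also have "\<dots> = (\<integral>z. ambiguity f z * Z z \<partial>lborel)"
  proof (intro Bochner_Integration.integral_cong refl)
    fix z :: "'a \<times> 'a"
    have "(\<integral>x. Q x z \<partial>lborel) = (\<integral>x. (cis (- 2 * pi * (x \<bullet> snd z)) * wigner_kernel f x (fst z)) * Z z \<partial>lborel)"
      by (simp add: Q_def mult_ac inner_commute)
    also have "\<dots> = (\<integral>x. cis (- 2 * pi * (x \<bullet> snd z)) * wigner_kernel f x (fst z) \<partial>lborel) * Z z"
      by (rule integral_mult_left_zero)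
    also have "\<dots> = ambiguity f z * Z z"
      by (cases z) (simp add: fourier_lborel[OF kern_measurable])
    finally show "(\<integral>x. Q x z \<partial>lborel) = ambiguity f z * Z z" .
  qed
  finally show ?thesis .
qed

section \<open>The Born--Jordan distribution\<close>

lemma normalized_sinc_eq: "normalized_sinc t = sinc (pi * t)"
  by (simp add: normalized_sinc_def)

lemma isCont_normalized_sinc: "isCont normalized_sinc t"
  unfolding normalized_sinc_eq[abs_def]
  by (rule isCont_o2[OF _ isCont_sinc]) (intro continuous_intros)

lemma abs_normalized_sinc_le: "\<bar>normalized_sinc t\<bar> \<le> 1"
proof (cases "t = 0")
  case False
  then show ?thesis
    using abs_sin_x_le_abs_x[of "pi * t"] by (simp add: normalized_sinc_def abs_mult divide_le_eq)
qed (simp add: normalized_sinc_def)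

lemma mult_abs_normalized_sinc_le: "\<bar>t\<bar> * \<bar>normalized_sinc t\<bar> \<le> 1"
proof -
  have "\<bar>t\<bar> * \<bar>normalized_sinc t\<bar> \<le> \<bar>sin (pi * t)\<bar> / pi"
    by (simp add: normalized_sinc_def abs_mult)
  also have "\<dots> \<le> 1"
  proof -
    have "\<bar>sin (pi * t)\<bar> \<le> pi"
      using pi_ge_two abs_sin_le_one[of "pi * t"] by linarith
    then show ?thesis by simp
  qed
  finally show ?thesis .
qed

lemma theta_eq: "theta n z = complex_of_real (normalized_sinc (fst z \<bullet> snd z) ^ n)"
  by (cases z) simp

lemma isCont_theta: "isCont (theta n) z"
  unfolding theta_eq[abs_def]
  by (intro continuous_intros isCont_o2[OF _ isCont_normalized_sinc])

lemma theta_measurable [measurable]: "theta n \<in> borel_measurable borel"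
  by (intro borel_measurable_continuous_onI continuous_at_imp_continuous_on ballI isCont_theta)

lemma norm_theta_le: "norm (theta n z) \<le> 1"
  by (simp add: theta_eq norm_power power_le_one abs_normalized_sinc_le)

text \<open>Translation becomes a phase, so the inner pairing of the convolution becomes an ordinary
  Fourier transform evaluated at \<open>rot x\<close>. The reflection in \<open>- z\<close> comes
  from the transpose of the antisymmetric kernel.\<close>

lemma symp_fourier_translate:
  assumes [measurable]: "v \<in> borel_measurable borel"
  shows "symp_fourier (\<lambda>w. v (x + w)) (- z) = cis (- 2 * pi * (z \<bullet> rot x)) * fourier v (rot z)"
proof -
  have "symp_fourier (\<lambda>w. v (x + w)) (- z) = (\<integral>w. cis (- 2 * pi * (- z \<bullet> rot w)) * v (x + w) \<partial>lborel)"
    unfolding symp_fourier_def symp_rot by (rule integral_completion) measurable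
  also have "\<dots> = (\<integral>w. cis (- 2 * pi * (- z \<bullet> rot ((w + x) - x))) * v (w + x) \<partial>lborel)"
    by (simp add: add.commute)
  also have "\<dots> = (\<integral>w. cis (- 2 * pi * (- z \<bullet> rot (w - x))) * v w \<partial>lborel)"
    by (rule integral_lborel_shift) measurable
  also have "\<dots> = (\<integral>w. cis (- 2 * pi * (z \<bullet> rot x)) * (cis (- 2 * pi * (w \<bullet> rot z)) * v w) \<partial>lborel)"
  proof -
    have "- z \<bullet> rot (w - x) = w \<bullet> rot z + z \<bullet> rot x" for w
      using inner_rot_antisym[of "- z" "w - x"] inner_rot_antisym[of x z]
      by (simp add: rot_def inner_prod_def inner_diff_left inner_diff_right inner_commute)
    then show ?thesis
      unfolding mult.assoc[symmetric] cis_mult by (simp add: algebra_simps)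
  qed
  also have "\<dots> = cis (- 2 * pi * (z \<bullet> rot x)) * fourier v (rot z)"
    by (simp only: integral_mult_right_zero fourier_lborel[OF assms])
  finally show ?thesis .
qed

text \<open>The convolution with \<open>fourier \<phi>\<close>, written in the variable of the
  ambiguity function. It converges absolutely at every point, as the ambiguity function and
  \<open>theta n\<close> are bounded and \<open>fourier \<phi>\<close> is integrable.\<close>

definition born_jordan_fourier ::
    "nat \<Rightarrow> ('a::euclidean_space \<Rightarrow> complex) \<Rightarrow> ('a \<times> 'a \<Rightarrow> complex) \<Rightarrow> 'a \<times> 'a \<Rightarrow> complex" where
  "born_jordan_fourier n f \<phi> y = (\<integral>z. ambiguity f z * theta n z * fourier \<phi> (y + rot z) \<partial>lborel)"

context
  fixes f :: "'a::euclidean_space \<Rightarrow> complex" and c :: "'a \<times> 'a" and \<phi>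
  assumes f: "f \<in> borel_measurable borel"
    and f2: "integrable lborel (\<lambda>x. (norm (f x))\<^sup>2)"
    and \<phi>: "\<phi> \<in> bumps c"
begin

lemma born_jordan_fourier_measurable: "born_jordan_fourier n f \<phi> \<in> borel_measurable borel"
proof -
  note [measurable] = f bumps_measurable[OF \<phi>] wigner_measurable[OF f f2] ambiguity_measurable[OF f f2]
  show ?thesis
    unfolding born_jordan_fourier_def[abs_def] by measurable
qed

text \<open>Unfolding the transposes leaves the Wigner distribution paired with the rotated
  transform of \<open>Z\<close>, the product of \<open>theta n\<close> with the rotated
  \<open>fourier v\<close>. After \<open>wigner_pairing\<close>, the convolution formula for
  \<open>fourier v\<close> is inserted and the integrals are exchanged.\<close>

lemma born_jordan_pairing:
  assumes \<psi>: "rapidly_decreasing \<psi>"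
  shows "integrable lborel (\<lambda>y. born_jordan_fourier n f \<phi> y * \<psi> y)"
    and "born_jordan n f (\<lambda>x. \<phi> x * fourier \<psi> x) = (\<integral>y. born_jordan_fourier n f \<phi> y * \<psi> y \<partial>lborel)"
proof -
  note [measurable] = f bumps_measurable[OF \<phi>] wigner_measurable[OF f f2] ambiguity_measurable[OF f f2]
  note [measurable] = rapidly_decreasing_measurable[OF \<psi>]
  define v where "v x = \<phi> x * fourier \<psi> x" for x
  have v_meas[measurable]: "v \<in> borel_measurable borel" unfolding v_def[abs_def] by measurable
  note v = fourier_bump_mult_fourier[OF \<phi> \<psi>, folded v_def]
  define Z where "Z z = theta n z * fourier v (rot z)" for z
  obtain C where C: "0 \<le> C" "\<And>x. norm (fourier v x) \<le> C / weight x ^ (2 * DIM('a))"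
    using rapidly_decreasingE[OF v(2)] by blast
  have Zc: "isCont Z z" for z
    unfolding Z_def[abs_def]
    by (intro continuous_intros isCont_theta isCont_o2[OF isCont_rot continuous_fourier[OF v(3)]])
  have Zb: "norm (Z z) \<le> C / weight z ^ (2 * DIM('a))" for z
    using mult_mono[OF norm_theta_le[of n z] C(2)[of "rot z"]] by (simp add: Z_def norm_mult)
  have Zm[measurable]: "Z \<in> borel_measurable borel" unfolding Z_def[abs_def] by measurable
  define P where "P z y = ambiguity f z * theta n z * fourier \<phi> (y + rot z) * \<psi> y" for z y
  have Pm[measurable]: "(\<lambda>(z, y). P z y) \<in> borel_measurable (borel \<Otimes>\<^sub>M borel)"
    unfolding P_def by measurable
  \<comment> \<open>The ambiguity factor is bounded; the rest is a product of two integrable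
    functions after a rotation and a shift.\<close>
  have P: "integrable (lborel \<Otimes>\<^sub>M lborel) (\<lambda>(z, y). P z y)"
  proof (rule integrableI_bounded)
    define M where "M = (\<integral>x. (norm (f x))\<^sup>2 \<partial>lborel)"
    define I where "I = (\<integral>\<^sup>+z. ennreal (norm (fourier \<phi> z)) \<partial>lborel)"
    have M: "0 \<le> M" unfolding M_def by simp
    have "(\<integral>\<^sup>+x. ennreal (norm (case x of (z, y) \<Rightarrow> P z y)) \<partial>(lborel \<Otimes>\<^sub>M lborel)) =
       (\<integral>\<^sup>+y. \<integral>\<^sup>+z. ennreal (norm (P z y)) \<partial>lborel \<partial>lborel)"
      by (subst lborel_pair.nn_integral_snd[symmetric]) auto
    also have "\<dots> \<le> (\<integral>\<^sup>+y. \<integral>\<^sup>+z. ennreal (M * norm (\<psi> y)) * ennreal (norm (fourier \<phi> (rot z + y))) \<partial>lborel \<partial>lborel)"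
    proof (intro nn_integral_mono)
      fix y z
      have "norm (ambiguity f z * theta n z) \<le> M * 1"
        unfolding norm_mult M_def by (intro mult_mono norm_ambiguity_le[OF f f2] norm_theta_le) auto
      then have "norm (ambiguity f z * theta n z) * (norm (fourier \<phi> (rot z + y)) * norm (\<psi> y)) \<le>
          M * (norm (fourier \<phi> (rot z + y)) * norm (\<psi> y))"
        by (intro mult_right_mono) auto
      then show "ennreal (norm (P z y)) \<le> ennreal (M * norm (\<psi> y)) * ennreal (norm (fourier \<phi> (rot z + y)))"
        using M by (simp add: P_def norm_mult mult_ac add.commute ennreal_leI flip: ennreal_mult)
    qed
    also have "\<dots> = (\<integral>\<^sup>+y. ennreal (M * norm (\<psi> y)) * I \<partial>lborel)"
    proof (rule nn_integral_cong)
      fix y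
      have "(\<integral>\<^sup>+z. ennreal (norm (fourier \<phi> (rot z + y))) \<partial>lborel) = (\<integral>\<^sup>+z. ennreal (norm (fourier \<phi> (z + y))) \<partial>lborel)"
        by (rule nn_integral_rot) measurable
      also have "\<dots> = I"
        unfolding I_def by (rule nn_integral_lborel_shift) measurable
      finally show "(\<integral>\<^sup>+z. ennreal (M * norm (\<psi> y)) * ennreal (norm (fourier \<phi> (rot z + y))) \<partial>lborel) = ennreal (M * norm (\<psi> y)) * I"
        by (subst nn_integral_cmult) auto
    qed
    also have "\<dots> = ennreal M * (\<integral>\<^sup>+y. ennreal (norm (\<psi> y)) \<partial>lborel) * I"
      using M by (simp add: nn_integral_multc nn_integral_cmult ennreal_mult)
    also have "\<dots> < \<infinity>"
      using rapidly_decreasing_integrable[OF \<psi>, of 0]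
        rapidly_decreasing_integrable[OF bumps_fourier_rapidly_decreasing[OF \<phi>], of 0]
      unfolding I_def integrable_iff_bounded by (simp add: ennreal_mult_less_top)
    finally show "(\<integral>\<^sup>+x. ennreal (norm (case x of (z, y) \<Rightarrow> P z y)) \<partial>(lborel \<Otimes>\<^sub>M lborel)) < \<infinity>" .
  qed simp
  have Psnd: "(\<integral>z. P z y \<partial>lborel) = born_jordan_fourier n f \<phi> y * \<psi> y" for y
    unfolding P_def born_jordan_fourier_def by (rule integral_mult_left_zero)
  show "integrable lborel (\<lambda>y. born_jordan_fourier n f \<phi> y * \<psi> y)"
    using lborel_pair.integrable_snd[OF P] by (simp only: Psnd)
  have "born_jordan n f v = (LINT x|lebesgue. wigner f x * (LINT z|lebesgue. theta n z * symp_fourier (\<lambda>w. v (x + w)) (- z)))"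
    by (simp add: born_jordan_def conv_distr_def regular_distr_def symp_fourier_distr_def)
  also have "\<dots> = (LINT x|lebesgue. wigner f x * fourier Z (rot x))"
  proof -
    have "theta n z * symp_fourier (\<lambda>w. v (x + w)) (- z) = cis (- 2 * pi * (z \<bullet> rot x)) * Z z" for x z
      unfolding symp_fourier_translate[OF v_meas] Z_def by (rule mult.left_commute)
    then show ?thesis
      unfolding fourier_def[of Z] by simp
  qed
  also have "\<dots> = (\<integral>x. wigner f x * fourier Z (rot x) \<partial>lborel)"
    by (rule integral_completion) measurable
  also have "\<dots> = (\<integral>z. ambiguity f z * Z z \<partial>lborel)"
    by (rule wigner_pairing[OF f f2 Zc Zb])
  also have "\<dots> = (\<integral>z. \<integral>y. P z y \<partial>lborel \<partial>lborel)"
  proof -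
    have "ambiguity f z * Z z = (\<integral>y. P z y \<partial>lborel)" for z
      by (simp only: Z_def v(1) P_def mult.assoc integral_mult_right_zero add.commute[of "rot z"])
    then show ?thesis by simp
  qed
  also have "\<dots> = (\<integral>y. \<integral>z. P z y \<partial>lborel \<partial>lborel)"
    by (rule lborel_pair.Fubini_integral[OF P, symmetric])
  finally show "born_jordan n f (\<lambda>x. \<phi> x * fourier \<psi> x) = (\<integral>y. born_jordan_fourier n f \<phi> y * \<psi> y \<partial>lborel)"
    by (simp only: v_def[abs_def] Psnd)
qed

lemma represents_born_jordan_fourier:
  "represents (born_jordan_fourier n f \<phi>) (fourier_distr (mult_distr \<phi> (born_jordan n f)))"
  unfolding represents_def fourier_distr_def mult_distr_def regular_distr_def
proof (intro allI impI conjI)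
  fix \<psi> :: "'a \<times> 'a \<Rightarrow> complex" assume "schwartz \<psi>"
  then have \<psi>: "rapidly_decreasing \<psi>" by (rule schwartz_rapidly_decreasing)
  note [measurable] = rapidly_decreasing_measurable[OF \<psi>] born_jordan_fourier_measurable
  show "integrable lebesgue (\<lambda>x. born_jordan_fourier n f \<phi> x * \<psi> x)"
    by (subst integrable_completion) (measurable, rule born_jordan_pairing[OF \<psi>])
  show "born_jordan n f (\<lambda>x. \<phi> x * fourier \<psi> x) = (LINT x|lebesgue. born_jordan_fourier n f \<phi> x * \<psi> x)"
    unfolding born_jordan_pairing(2)[OF \<psi>] by (rule integral_completion[symmetric]) measurable
qed

end

text \<open>The frequency belonging to \<open>z\<close> is \<open>- rot z\<close>, so that \<open>\<omega> + rot z\<close> is the difference of two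
  frequencies.\<close>

lemma weight_sinc_bound:
  fixes \<omega> z :: "'a::euclidean_space \<times> 'a"
  assumes c: "0 < c" and \<omega>: "c * (norm \<omega>)\<^sup>2 \<le> \<bar>fst \<omega> \<bullet> snd \<omega>\<bar>"
  shows "weight \<omega> * \<bar>normalized_sinc (fst z \<bullet> snd z)\<bar> \<le> (1 + 2 / c + 2 / c * (1 + 2 / c)) * weight (\<omega> + rot z)"
proof -
  define h where "h = \<omega> + rot z"
  define q where "q = fst z \<bullet> snd z"
  have z: "fst z = snd h - snd \<omega>" "snd z = fst \<omega> - fst h"
    by (auto simp: h_def rot_def)
  have n: "norm (fst \<omega>) \<le> norm \<omega>" "norm (snd \<omega>) \<le> norm \<omega>" "norm (fst h) \<le> norm h" "norm (snd h) \<le> norm h"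
    using norm_fst_le[of "fst \<omega>" "snd \<omega>"] norm_snd_le[of "snd \<omega>" "fst \<omega>"]
      norm_fst_le[of "fst h" "snd h"] norm_snd_le[of "snd h" "fst h"] by simp_all
  have "fst \<omega> \<bullet> snd \<omega> = - q + snd h \<bullet> fst \<omega> - snd h \<bullet> fst h + snd \<omega> \<bullet> fst h"
    unfolding q_def z by (simp add: inner_diff_left inner_diff_right inner_commute algebra_simps)
  then have "\<bar>fst \<omega> \<bullet> snd \<omega>\<bar> \<le> \<bar>q\<bar> + \<bar>snd h \<bullet> fst \<omega>\<bar> + \<bar>snd h \<bullet> fst h\<bar> + \<bar>snd \<omega> \<bullet> fst h\<bar>"
    by linarith
  also have "\<bar>snd h \<bullet> fst \<omega>\<bar> \<le> norm h * norm \<omega>"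
    by (rule order_trans[OF Cauchy_Schwarz_ineq2]) (intro mult_mono n; simp)
  also have "\<bar>snd h \<bullet> fst h\<bar> \<le> norm h * norm h"
    by (rule order_trans[OF Cauchy_Schwarz_ineq2]) (intro mult_mono n; simp)
  also have "\<bar>snd \<omega> \<bullet> fst h\<bar> \<le> norm h * norm \<omega>"
    by (rule order_trans[OF Cauchy_Schwarz_ineq2]) (subst mult.commute, intro mult_mono n; simp)
  finally have 1: "c * (norm \<omega>)\<^sup>2 \<le> \<bar>q\<bar> + 2 * (norm h * norm \<omega>) + (norm h)\<^sup>2"
    using \<omega> by (simp add: power2_eq_square mult_ac)
  \<comment> \<open>The weights in this square are chosen so that the mixed term costs half of
    c|\<omega>|^2, which the left-hand side can afford, plus a multiple of |h|^2.\<close>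
  have "0 \<le> (c * norm \<omega> - 2 * norm h)\<^sup>2" by simp
  then have "4 * c * (norm h * norm \<omega>) \<le> c\<^sup>2 * (norm \<omega>)\<^sup>2 + 4 * (norm h)\<^sup>2"
    by (simp add: power2_diff power_mult_distrib mult_ac)
  then have "c * (4 * (norm h * norm \<omega>)) \<le> c * (c * (norm \<omega>)\<^sup>2 + 4 / c * (norm h)\<^sup>2)"
    using c by (simp add: algebra_simps power2_eq_square)
  then have 2: "2 * (norm h * norm \<omega>) \<le> c / 2 * (norm \<omega>)\<^sup>2 + 2 / c * (norm h)\<^sup>2"
    using c by simp
  from 1 2 have "c / 2 * (norm \<omega>)\<^sup>2 \<le> \<bar>q\<bar> + (1 + 2 / c) * (norm h)\<^sup>2"
    by (simp add: algebra_simps)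
  then have "2 / c * (c / 2 * (norm \<omega>)\<^sup>2) \<le> 2 / c * (\<bar>q\<bar> + (1 + 2 / c) * (norm h)\<^sup>2)"
    using c by (intro mult_left_mono) auto
  then have "weight \<omega> \<le> 1 + 2 / c * \<bar>q\<bar> + 2 / c * (1 + 2 / c) * (norm h)\<^sup>2"
  proof -
    have "2 / c * (c / 2 * (norm \<omega>)\<^sup>2) = (norm \<omega>)\<^sup>2" using c by simp
    moreover have "2 / c * (\<bar>q\<bar> + (1 + 2 / c) * (norm h)\<^sup>2) = 2 / c * \<bar>q\<bar> + 2 / c * (1 + 2 / c) * (norm h)\<^sup>2"
      by (simp only: distrib_left[of "2 / c" "\<bar>q\<bar>"] mult.assoc)
    ultimately show ?thesis
      using \<open>2 / c * (c / 2 * (norm \<omega>)\<^sup>2) \<le> 2 / c * (\<bar>q\<bar> + (1 + 2 / c) * (norm h)\<^sup>2)\<close>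
      unfolding weight_def by linarith
  qed
  then have "weight \<omega> * \<bar>normalized_sinc q\<bar> \<le> (1 + 2 / c * \<bar>q\<bar> + 2 / c * (1 + 2 / c) * (norm h)\<^sup>2) * \<bar>normalized_sinc q\<bar>"
    by (rule mult_right_mono) simp
  \<comment> \<open>The term with |q| is separated because there the decay of sinc cancels the
    growth; elsewhere sinc is merely bounded by 1.\<close>
  also have "\<dots> = (1 + 2 / c * (1 + 2 / c) * (norm h)\<^sup>2) * \<bar>normalized_sinc q\<bar> + 2 / c * (\<bar>q\<bar> * \<bar>normalized_sinc q\<bar>)"
    by (simp add: algebra_simps)
  also have "\<dots> \<le> (1 + 2 / c * (1 + 2 / c) * (norm h)\<^sup>2) * 1 + 2 / c * 1"
    using c by (intro add_mono mult_left_mono abs_normalized_sinc_le mult_abs_normalized_sinc_le) auto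
  also have "\<dots> \<le> (1 + 2 / c + 2 / c * (1 + 2 / c)) * weight h"
  proof -
    have "0 \<le> 2 / c * (1 + 2 / c)" "0 \<le> (1 + 2 / c) * (norm h)\<^sup>2" using c by auto
    then show ?thesis by (simp add: weight_def distrib_left distrib_right)
  qed
  finally show ?thesis unfolding q_def h_def .
qed

text \<open>Young's inequality for an integrable and a square integrable function: splitting
  \<open>k\<close> into two square roots, Cauchy-Schwarz leaves one factor of mass \<open>I\<close>,
  and Fubini produces the second.\<close>

lemma schur_rot:
  fixes k a :: "'a::euclidean_space \<times> 'a \<Rightarrow> ennreal"
  assumes [measurable]: "k \<in> borel_measurable borel" "a \<in> borel_measurable borel"
    and k: "(\<integral>\<^sup>+x. k x \<partial>lborel) < \<infinity>" and a: "(\<integral>\<^sup>+x. (a x)\<^sup>2 \<partial>lborel) < \<infinity>"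
  shows "(\<integral>\<^sup>+\<omega>. (\<integral>\<^sup>+z. a z * k (\<omega> + rot z) \<partial>lborel)\<^sup>2 \<partial>lborel) < \<infinity>"
proof -
  define I where "I = (\<integral>\<^sup>+x. k x \<partial>lborel)"
  have "(\<integral>\<^sup>+z. a z * k (\<omega> + rot z) \<partial>lborel)\<^sup>2 \<le> (\<integral>\<^sup>+z. (a z)\<^sup>2 * k (\<omega> + rot z) \<partial>lborel) * I" for \<omega>
  proof -
    \<comment> \<open>The detour through \<open>enn2real\<close> loses infinite values of
      \<open>k\<close>, but these form a null set since \<open>k\<close> has finite
      integral.\<close>
    define s where "s x = ennreal (sqrt (enn2real (k x)))" for x
    have [measurable]: "s \<in> borel_measurable borel" unfolding s_def[abs_def] by measurable
    have I: "(\<integral>\<^sup>+z. k (\<omega> + rot z) \<partial>lborel) = I"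
    proof -
      have "(\<integral>\<^sup>+z. k (\<omega> + rot z) \<partial>lborel) = (\<integral>\<^sup>+z. k (\<omega> + z) \<partial>lborel)"
        by (rule nn_integral_rot) measurable
      also have "\<dots> = I"
        unfolding I_def using nn_integral_lborel_shift[of k \<omega>] by (simp add: add.commute)
      finally show ?thesis .
    qed
    then have "AE z in lborel. k (\<omega> + rot z) \<noteq> \<infinity>"
      using k by (intro nn_integral_noteq_infinite) (auto simp: I_def)
    then have ae: "AE z in lborel. k (\<omega> + rot z) = (s (\<omega> + rot z))\<^sup>2"
      by eventually_elim (auto simp: s_def ennreal_power less_top)
    have "(\<integral>\<^sup>+z. a z * k (\<omega> + rot z) \<partial>lborel) = (\<integral>\<^sup>+z. (a z * s (\<omega> + rot z)) * s (\<omega> + rot z) \<partial>lborel)"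
      by (rule nn_integral_cong_AE) (use ae in eventually_elim, simp add: power2_eq_square mult.assoc)
    also have "\<dots>\<^sup>2 \<le> (\<integral>\<^sup>+z. (a z * s (\<omega> + rot z))\<^sup>2 \<partial>lborel) * (\<integral>\<^sup>+z. (s (\<omega> + rot z))\<^sup>2 \<partial>lborel)"
      by (rule Cauchy_Schwarz_nn_integral) measurable
    also have "(\<integral>\<^sup>+z. (s (\<omega> + rot z))\<^sup>2 \<partial>lborel) = I"
      unfolding I[symmetric] by (rule nn_integral_cong_AE) (use ae in eventually_elim, simp)
    also have "(\<integral>\<^sup>+z. (a z * s (\<omega> + rot z))\<^sup>2 \<partial>lborel) = (\<integral>\<^sup>+z. (a z)\<^sup>2 * k (\<omega> + rot z) \<partial>lborel)"
      by (rule nn_integral_cong_AE) (use ae in eventually_elim, simp add: power_mult_distrib)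
    finally show ?thesis .
  qed
  then have "(\<integral>\<^sup>+\<omega>. (\<integral>\<^sup>+z. a z * k (\<omega> + rot z) \<partial>lborel)\<^sup>2 \<partial>lborel) \<le>
     (\<integral>\<^sup>+\<omega>. (\<integral>\<^sup>+z. (a z)\<^sup>2 * k (\<omega> + rot z) \<partial>lborel) * I \<partial>lborel)"
    by (rule nn_integral_mono)
  also have "\<dots> = (\<integral>\<^sup>+\<omega>. \<integral>\<^sup>+z. (a z)\<^sup>2 * k (\<omega> + rot z) \<partial>lborel \<partial>lborel) * I"
    by (rule nn_integral_multc) measurable
  also have "(\<integral>\<^sup>+\<omega>. \<integral>\<^sup>+z. (a z)\<^sup>2 * k (\<omega> + rot z) \<partial>lborel \<partial>lborel) =
      (\<integral>\<^sup>+z. \<integral>\<^sup>+\<omega>. (a z)\<^sup>2 * k (\<omega> + rot z) \<partial>lborel \<partial>lborel)"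
    by (rule lborel_pair.Fubini') measurable
  also have "\<dots> = (\<integral>\<^sup>+z. (a z)\<^sup>2 * I \<partial>lborel)"
  proof (rule nn_integral_cong)
    fix z :: "'a \<times> 'a"
    show "(\<integral>\<^sup>+\<omega>. (a z)\<^sup>2 * k (\<omega> + rot z) \<partial>lborel) = (a z)\<^sup>2 * I"
      by (subst nn_integral_cmult) (simp_all add: nn_integral_lborel_shift I_def)
  qed
  also have "\<dots> = (\<integral>\<^sup>+z. (a z)\<^sup>2 \<partial>lborel) * I"
    by (rule nn_integral_multc) measurable
  also have "\<dots> * I < \<infinity>"
    using a k by (simp add: I_def ennreal_mult_less_top)
  finally show ?thesis .
qed

section \<open>Sobolev regularity on the cone\<close>

lemma born_jordan_sobolev_regular:
  fixes f :: "'a::euclidean_space \<Rightarrow> complex" and z :: "'a \<times> 'a"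
  assumes "square_integrable f" and "\<zeta>1 \<bullet> \<zeta>2 \<noteq> 0"
  shows "sobolev_regular_at (real (2 * n)) (born_jordan n f) z (\<zeta>1, \<zeta>2)"
proof -
  obtain g :: "'a \<Rightarrow> complex" where g: "g \<in> borel_measurable borel"
      and g2: "integrable lborel (\<lambda>x. (norm (g x))\<^sup>2)" and W: "wigner g = wigner f"
    by (rule square_integrable_borel_representative[OF assms(1)])
  \<comment> \<open>The Born-Jordan distribution depends on its function only through the Wigner
    distribution, so the Borel representative can be used throughout.\<close>
  have bj: "born_jordan n f = born_jordan n g"
    unfolding born_jordan_def W ..
  define \<phi> where "\<phi> x = complex_of_real (flat_exp 0 (1 - (norm (x - z))\<^sup>2))" for x
  have \<phi>: "\<phi> \<in> bumps z"
    unfolding \<phi>_def[abs_def] by (rule bumps.flat)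
  have \<phi>z: "\<phi> z \<noteq> 0"
    by (simp add: \<phi>_def flat_exp_def)
  define \<zeta> where "\<zeta> = (\<zeta>1, \<zeta>2)"
  have \<zeta>: "\<zeta> \<noteq> 0" "fst \<zeta> \<bullet> snd \<zeta> \<noteq> 0"
    using assms(2) by (auto simp: \<zeta>_def zero_prod_def)
  \<comment> \<open>Half of the ratio attained at \<zeta>, so the strict inequality defining
    \<Gamma> holds there. Both of its sides are homogeneous of degree two, which makes \<Gamma>
    conic.\<close>
  define c where "c = \<bar>fst \<zeta> \<bullet> snd \<zeta>\<bar> / (2 * (norm \<zeta>)\<^sup>2)"
  have c: "0 < c" using \<zeta> by (simp add: c_def)
  define \<Gamma> where "\<Gamma> = {\<omega> :: 'a \<times> 'a. c * (norm \<omega>)\<^sup>2 < \<bar>fst \<omega> \<bullet> snd \<omega>\<bar>}"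
  have \<Gamma>: "open_conic_nhd \<zeta> \<Gamma>"
    unfolding open_conic_nhd_def
  proof (intro conjI ballI allI impI)
    show "open \<Gamma>"
      unfolding \<Gamma>_def by (intro open_Collect_less continuous_intros)
    show "\<Gamma> \<subseteq> UNIV - {0}" by (auto simp: \<Gamma>_def)
    show "\<zeta> \<in> \<Gamma>" using \<zeta> by (simp add: \<Gamma>_def c_def)
    fix \<omega> and t :: real assume \<omega>: "\<omega> \<in> \<Gamma>" and t: "t > 0"
    have "t\<^sup>2 * (c * (norm \<omega>)\<^sup>2) < t\<^sup>2 * \<bar>fst \<omega> \<bullet> snd \<omega>\<bar>"
      using \<omega> t by (intro mult_strict_left_mono) (auto simp: \<Gamma>_def)
    then show "t *\<^sub>R \<omega> \<in> \<Gamma>"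
      using t by (simp add: \<Gamma>_def power_mult_distrib abs_mult power2_eq_square mult_ac)
  qed
  define K where "K = 1 + 2 / c + 2 / c * (1 + 2 / c)"
  have K: "0 < K" using c by (simp add: K_def add_pos_pos)
  \<comment> \<open>The convolution kernel after the weight has been moved from \<omega> to the
    difference of frequencies; rapid decay of \<open>fourier \<phi>\<close> keeps it
    integrable.\<close>
  define k where "k h = K ^ n * (weight h ^ n * norm (fourier \<phi> h))" for h
  have k0: "0 \<le> k h" for h using K by (simp add: k_def)
  note [measurable] = bumps_measurable[OF \<phi>] ambiguity_measurable[OF g g2]
  have [measurable]: "k \<in> borel_measurable borel"
    unfolding k_def[abs_def] by measurable
  let ?G = "born_jordan_fourier n g \<phi>"
  have bound: "ennreal (norm (?G \<omega>) * weight \<omega> ^ n) \<le>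
      (\<integral>\<^sup>+y. ennreal (norm (ambiguity g y)) * ennreal (k (\<omega> + rot y)) \<partial>lborel)" if \<omega>: "\<omega> \<in> \<Gamma>" for \<omega>
  proof -
    have le: "weight \<omega> ^ n * norm (theta n y) \<le> K ^ n * weight (\<omega> + rot y) ^ n" for y
    proof -
      have "(weight \<omega> * \<bar>normalized_sinc (fst y \<bullet> snd y)\<bar>) ^ n \<le> (K * weight (\<omega> + rot y)) ^ n"
        unfolding K_def using c \<omega> by (intro power_mono weight_sinc_bound) (auto simp: \<Gamma>_def)
      then show ?thesis
        by (simp add: theta_eq norm_power power_mult_distrib)
    qed
    have "ennreal (norm (?G \<omega>) * weight \<omega> ^ n) = ennreal (weight \<omega> ^ n) * ennreal (norm (?G \<omega>))"
      by (simp add: mult.commute flip: ennreal_mult)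
    also have "\<dots> \<le> ennreal (weight \<omega> ^ n) * (\<integral>\<^sup>+y. norm (ambiguity g y * theta n y * fourier \<phi> (\<omega> + rot y)) \<partial>lborel)"
      unfolding born_jordan_fourier_def by (intro mult_left_mono norm_integral_le_nn_integral) simp
    also have "\<dots> = (\<integral>\<^sup>+y. ennreal (weight \<omega> ^ n) * norm (ambiguity g y * theta n y * fourier \<phi> (\<omega> + rot y)) \<partial>lborel)"
      by (rule nn_integral_cmult[symmetric]) measurable
    also have "\<dots> \<le> (\<integral>\<^sup>+y. ennreal (norm (ambiguity g y)) * ennreal (k (\<omega> + rot y)) \<partial>lborel)"
    proof (rule nn_integral_mono)
      fix y
      have "(weight \<omega> ^ n * norm (theta n y)) * (norm (ambiguity g y) * norm (fourier \<phi> (\<omega> + rot y))) \<le>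
        (K ^ n * weight (\<omega> + rot y) ^ n) * (norm (ambiguity g y) * norm (fourier \<phi> (\<omega> + rot y)))"
        by (intro mult_right_mono le) simp
      then have "weight \<omega> ^ n * norm (ambiguity g y * theta n y * fourier \<phi> (\<omega> + rot y)) \<le>
          norm (ambiguity g y) * k (\<omega> + rot y)"
        by (simp add: k_def norm_mult mult_ac)
      then show "ennreal (weight \<omega> ^ n) * ennreal (norm (ambiguity g y * theta n y * fourier \<phi> (\<omega> + rot y))) \<le>
         ennreal (norm (ambiguity g y)) * ennreal (k (\<omega> + rot y))"
        using k0 by (simp add: ennreal_leI flip: ennreal_mult)
    qed
    finally show ?thesis .
  qed
  have jb: "japanese_bracket \<omega> powr real (2 * n) = weight \<omega> ^ n" for \<omega> :: "'a \<times> 'a"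
  proof -
    have "japanese_bracket \<omega> > 0" "(japanese_bracket \<omega>)\<^sup>2 = weight \<omega>"
      by (simp_all add: japanese_bracket_def weight_def add_pos_nonneg)
    then show ?thesis
      by (simp only: powr_realpow power_mult)
  qed
  have "(\<integral>\<^sup>+\<omega>\<in>\<Gamma>. ennreal ((norm (?G \<omega>) * japanese_bracket \<omega> powr real (2 * n))\<^sup>2) \<partial>lebesgue) \<le>
    (\<integral>\<^sup>+\<omega>. (\<integral>\<^sup>+y. ennreal (norm (ambiguity g y)) * ennreal (k (\<omega> + rot y)) \<partial>lborel)\<^sup>2 \<partial>lborel)"
    unfolding nn_integral_completion jb
  proof (rule nn_integral_mono)
    fix \<omega>
    show "ennreal ((norm (?G \<omega>) * weight \<omega> ^ n)\<^sup>2) * indicator \<Gamma> \<omega> \<le>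
      (\<integral>\<^sup>+y. ennreal (norm (ambiguity g y)) * ennreal (k (\<omega> + rot y)) \<partial>lborel)\<^sup>2"
    proof (cases "\<omega> \<in> \<Gamma>")
      case True
      then show ?thesis
        using power_mono[OF bound[OF True], of 2] by (simp add: ennreal_power)
    qed simp
  qed
  also have "\<dots> < \<infinity>"
  proof (rule schur_rot)
    show "(\<integral>\<^sup>+x. (ennreal (norm (ambiguity g x)))\<^sup>2 \<partial>lborel) < \<infinity>"
      using ambiguity_L2[OF g g2] by (simp add: ennreal_power)
    have "integrable lborel (\<lambda>h. K ^ n * norm (weight h ^ n *\<^sub>R fourier \<phi> h))"
      by (intro integrable_mult_right integrable_norm rapidly_decreasing_integrable bumps_fourier_rapidly_decreasing[OF \<phi>])
    then have "integrable lborel k"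
      by (simp add: k_def[abs_def])
    then show "(\<integral>\<^sup>+x. ennreal (k x) \<partial>lborel) < \<infinity>"
      using k0 by (simp add: integrable_iff_bounded)
  qed measurable
  finally show ?thesis
    unfolding \<zeta>_def[symmetric] sobolev_regular_at_def bj
    by (intro exI[of _ \<phi>] exI[of _ \<Gamma>] exI[of _ ?G] conjI bumps_smooth[OF \<phi>] bumps_compactly_supported[OF \<phi>]
        \<phi>z \<Gamma> represents_born_jordan_fourier[OF g g2 \<phi>])
qed

theorem corollary1p4:
  fixes n :: nat
    and f :: "real ^ 'd \<Rightarrow> complex"
    and z :: "(real ^ 'd) \<times> (real ^ 'd)"
    and \<zeta>1 \<zeta>2 :: "real ^ 'd"
  assumes "n \<ge> 1"
    and "square_integrable f"
    and "\<zeta>1 \<bullet> \<zeta>2 \<noteq> 0"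
  shows "(z, (\<zeta>1, \<zeta>2)) \<notin> sobolev_wave_front_set (real (2 * n)) (born_jordan n f)"
  using born_jordan_sobolev_regular[OF assms(2,3)] by (simp add: sobolev_wave_front_set_def)

end
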